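(* Let $A, B$ be Blaschke products of the same degree, and let $A^*, B^*$ be Blaschke products of the same degree (the degree of $A, B$ is not assumed equal to that of $A^*, B^*$). Then the pairs $(A,B)$ and $(A^*,B^* )$ share the same welding homeomorphism, i.e. there exists a single homeomorphism $k:\mathbb{T}\to\mathbb{T}$ such that $A\circ k=B$ and $A^*\circ k=B^*$ on $\mathbb{T}$, if and only if there exist Blaschke products $A_1$, $B_1$, $C$, $C^*$ such that $$A=C\circ A_1,\quad B=C\circ B_1,\quad A^*=C^*\circ A_1,\quad B^*=C^*\circ B_1 .$$
   Context: $\mathbb{D}=\{z:|z|<1\}$ and $\mathbb{T}=\{z:|z|=1\}$. A Blaschke product is a rational map of degree $\geq 1$ (in particular non-constant) whose restriction to $\mathbb{D}$ is a proper map onto $\mathbb{D}$; equivalently, a finite Blaschke product of degree at least one. Given two Blaschke products $A,B$ of the same degree, a welding homeomorphism of the pair $A,B$ is a homeomorphism $k:\mathbb{T}\to\mathbb{T}$ satisfying $A\circ k=B$ on $\mathbb{T}$. *)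

theory Defs
  imports "HOL-Analysis.Analysis" "HOL-Computational_Algebra.Polynomial_Factorial"
    "HOL-Computational_Algebra.Field_as_Ring"
begin

(* The Riemann sphere is the one-point compactification of the plane: None is the point at
   infinity and Some z the finite point z. Rational maps act on the whole sphere, so that
   composition and equality of rational maps are those of functions. *)

abbreviation riemann_sphere :: "complex option topology" where
  "riemann_sphere \<equiv> Alexandroff_compactification euclidean"

abbreviation unit_disc :: "complex option set" where
  "unit_disc \<equiv> Some ` ball 0 1"

(* The map p/q for coprime p and q. At infinity, after multiplying numerator and denominator
   by z^(-d) with d = max (degree p) (degree q), only the coefficients of index d survive;
   they are not both zero unless p = q = 0. *)

definition quotient_map_of_polys :: "complex poly \<Rightarrow> complex poly \<Rightarrow> complex option \<Rightarrow> complex option" where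
  "quotient_map_of_polys p q w =
     (case w of
        Some z \<Rightarrow> if poly q z = 0 then None else Some (poly p z / poly q z)
      | None \<Rightarrow>
          (let d = max (degree p) (degree q)
           in if coeff q d = 0 then None else Some (coeff p d / coeff q d)))"

definition represents_rational :: "complex poly \<Rightarrow> complex poly \<Rightarrow> (complex option \<Rightarrow> complex option) \<Rightarrow> bool" where
  "represents_rational p q f \<longleftrightarrow> q \<noteq> 0 \<and> coprime p q \<and> f = quotient_map_of_polys p q"

definition rational_map :: "(complex option \<Rightarrow> complex option) \<Rightarrow> bool" where
  "rational_map f \<longleftrightarrow> (\<exists>p q. represents_rational p q f)"

(* Only meaningful for rational maps, where the lemma rational_degree_eq shows that it does
   not depend on the chosen representation. *)

definition rational_degree :: "(complex option \<Rightarrow> complex option) \<Rightarrow> nat" where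
  "rational_degree f =
     (THE d. \<exists>p q. represents_rational p q f \<and> d = max (degree p) (degree q))"

definition blaschke_product :: "(complex option \<Rightarrow> complex option) \<Rightarrow> bool" where
  "blaschke_product f \<longleftrightarrow>
     rational_map f \<and> rational_degree f \<ge> 1 \<and>
     f ` unit_disc = unit_disc \<and>
     proper_map (subtopology riemann_sphere unit_disc) (subtopology riemann_sphere unit_disc) f"

(* In the library predicate homeomorphism the inverse map is a fourth argument. *)

definition welding_homeomorphism ::
  "(complex option \<Rightarrow> complex option) \<Rightarrow> (complex option \<Rightarrow> complex option) \<Rightarrow> (complex \<Rightarrow> complex) \<Rightarrow> bool" where
  "welding_homeomorphism A B k \<longleftrightarrow>
     (\<exists>k'. homeomorphism (sphere 0 1) (sphere 0 1) k k') \<and>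
     (\<forall>z\<in>sphere 0 1. A (Some (k z)) = B (Some z))"

lemma represents_rational_cross:
  assumes "represents_rational p q f" "represents_rational r s f"
  shows "p * s = r * q"
proof (rule ccontr)
  assume ne: "p * s \<noteq> r * q"
  have eq: "quotient_map_of_polys p q = quotient_map_of_polys r s"
    and q0: "q \<noteq> 0" and s0: "s \<noteq> 0"
    using assms by (auto simp: represents_rational_def)
  have "poly ((p * s - r * q) * q * s) z = 0" for z
  proof (cases "poly q z = 0 \<or> poly s z = 0")
    case True
    then show ?thesis by auto
  next
    case False
    then have "poly p z / poly q z = poly r z / poly s z"
      using fun_cong[OF eq, of "Some z"] by (simp add: quotient_map_of_polys_def)
    with False have "poly p z * poly s z = poly r z * poly q z"
      by (simp add: frac_eq_eq)
    then show ?thesis by simp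
  qed
  then have "(p * s - r * q) * q * s = 0"
    using poly_all_0_iff_0 by blast
  with ne q0 s0 show False by simp
qed

lemma rational_degree_eq:
  assumes "represents_rational p q f"
  shows "rational_degree f = max (degree p) (degree q)"
  unfolding rational_degree_def
proof (rule the_equality)
  fix d
  assume "\<exists>r s. represents_rational r s f \<and> d = max (degree r) (degree s)"
  then obtain r s where rs: "represents_rational r s f" and d: "d = max (degree r) (degree s)"
    by blast
  have eq: "p * s = r * q"
    using represents_rational_cross[OF assms rs] .
  have cop: "coprime p q" "coprime r s" and nz: "q \<noteq> 0" "s \<noteq> 0"
    using assms rs by (auto simp: represents_rational_def)
  have "q dvd s"
  proof -
    have "q dvd p * s" unfolding eq by simp
    with cop(1) show ?thesis
      by (subst (asm) coprime_dvd_mult_right_iff) (simp_all add: coprime_commute)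
  qed
  moreover have "s dvd q"
  proof -
    have "s dvd r * q" unfolding eq[symmetric] by simp
    with cop(2) show ?thesis
      by (subst (asm) coprime_dvd_mult_right_iff) (simp_all add: coprime_commute)
  qed
  ultimately have ds: "degree q = degree s"
    using nz by (simp add: dvd_imp_degree_le le_antisym)
  have "degree p = degree r"
  proof (cases "p = 0 \<or> r = 0")
    case True
    with eq nz show ?thesis by auto
  next
    case False
    then have "degree p + degree s = degree r + degree q"
      using arg_cong[OF eq, of degree] nz by (simp add: degree_mult_eq)
    with ds show ?thesis by simp
  qed
  with d ds show "d = max (degree p) (degree q)" by simp
qed (use assms in blast)

end

theory Submission
  imports Defs "HOL-Complex_Analysis.Conformal_Mappings"
    "HOL-Computational_Algebra.Fundamental_Theorem_Algebra"
begin

text \<open>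
  Let a homeomorphism \<open>k\<close> of the unit circle be given. The rational functions \<open>f\<close> for which
  \<open>f \<circ> k\<close> agrees on the circle with some rational function form a subfield \<open>K\<close> of the rational
  function field, and \<open>A\<close>, \<open>A\<^sup>*\<close> lie in \<open>K\<close> when \<open>k\<close> welds both pairs. By Lueroth's theorem \<open>K\<close> is
  generated by one function, which can be chosen as a coefficient of the minimal polynomial over
  \<open>K\<close> of the variable. The constant coefficient is up to sign the product of the conjugates of the
  variable, and these stay in a fibre of \<open>A\<close>; so it has modulus one on the circle, no poles in the
  disc and a zero at the origin, that is, it is a Blaschke product \<open>A\<^sub>1\<close>. Writing \<open>A = C \<circ> A\<^sub>1\<close>,
  \<open>A\<^sup>* = C\<^sup>* \<circ> A\<^sub>1\<close> and letting \<open>B\<^sub>1\<close> be the rational function that agrees with \<open>A\<^sub>1 \<circ> k\<close> gives the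
  four identities, since rational maps that agree on the circle are equal.

  Conversely \<open>A\<^sub>1\<close> and \<open>B\<^sub>1\<close> have equal degrees, so they lift to increasing homeomorphisms of the line
  with the same period increment, and these lifts are conjugate by the lift of a circle
  homeomorphism.
\<close>


section \<open>Rational maps of the Riemann sphere\<close>

text \<open>The form of degree \<open>d\<close> attached to \<open>p\<close>, which puts infinity,
  with coordinates 1 : 0, on the same footing as the finite points. The formal degree
  \<open>d\<close> may exceed \<open>degree p\<close>, because numerator and denominator of a
  rational map share one \<open>d\<close>.\<close>

definition homogeneous_eval :: "nat \<Rightarrow> complex poly \<Rightarrow> complex \<Rightarrow> complex \<Rightarrow> complex" where
  "homogeneous_eval d p x y = (\<Sum>i\<le>d. coeff p i * x ^ i * y ^ (d - i))"

definition sphere_point :: "complex \<Rightarrow> complex \<Rightarrow> complex option" where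
  "sphere_point x y = (if y = 0 then None else Some (x / y))"

text \<open>Numerator or denominator of a composition with g/h, after clearing denominators by
  \<open>h ^ d\<close>.\<close>

definition homogeneous_compose :: "nat \<Rightarrow> complex poly \<Rightarrow> complex poly \<Rightarrow> complex poly \<Rightarrow> complex poly" where
  "homogeneous_compose d p g h = (\<Sum>i\<le>d. smult (coeff p i) (g ^ i * h ^ (d - i)))"

lemma quotient_map_Some:
  "quotient_map_of_polys p q (Some z) = sphere_point (poly p z) (poly q z)"
  by (simp add: quotient_map_of_polys_def sphere_point_def)

lemma quotient_map_None:
  "quotient_map_of_polys p q None =
     sphere_point (coeff p (max (degree p) (degree q))) (coeff q (max (degree p) (degree q)))"
  by (simp add: quotient_map_of_polys_def sphere_point_def Let_def)

lemma sphere_point_scale: "c \<noteq> 0 \<Longrightarrow> sphere_point (c * x) (c * y) = sphere_point x y"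
  by (simp add: sphere_point_def)

lemma homogeneous_eval_nonzero:
  assumes "y \<noteq> 0" "degree p \<le> d"
  shows "homogeneous_eval d p x y = y ^ d * poly p (x / y)"
proof -
  have "poly p (x / y) = (\<Sum>i\<le>d. coeff p i * (x / y) ^ i)"
    unfolding poly_altdef by (rule sum.mono_neutral_left) (use assms in \<open>auto simp: coeff_eq_0\<close>)
  then have "y ^ d * poly p (x / y) = (\<Sum>i\<le>d. coeff p i * (y ^ d * (x / y) ^ i))"
    by (simp add: sum_distrib_left mult_ac)
  also have "\<dots> = homogeneous_eval d p x y"
    unfolding homogeneous_eval_def
    by (rule sum.cong) (use assms in \<open>auto simp: power_divide power_diff\<close>)
  finally show ?thesis by simp
qed

lemma homogeneous_eval_0: "homogeneous_eval d p x 0 = coeff p d * x ^ d"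
proof -
  have "homogeneous_eval d p x 0 = (\<Sum>i\<le>d. if i = d then coeff p i * x ^ i else 0)"
    unfolding homogeneous_eval_def by (rule sum.cong) auto
  then show ?thesis by simp
qed

lemma coprime_coeff_max_nz:
  fixes p q :: "complex poly"
  assumes "coprime p q"
  shows "coeff p (max (degree p) (degree q)) \<noteq> 0 \<or> coeff q (max (degree p) (degree q)) \<noteq> 0"
proof -
  have "p \<noteq> 0 \<or> q \<noteq> 0" using assms by auto
  then show ?thesis
    by (metis degree_0 le_zero_eq leading_coeff_0_iff linear max.absorb1 max.absorb2)
qed

text \<open>A common zero with \<open>y\<close> nonzero would be a common root of two coprime
  polynomials; one with \<open>y = 0\<close> would make both coefficients of index \<open>d\<close>
  vanish, although one of them is a leading coefficient.\<close>

lemma homogeneous_eval_no_common_zero: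
  assumes "coprime p q" "d = max (degree p) (degree q)" "x \<noteq> 0 \<or> y \<noteq> 0"
  shows "homogeneous_eval d p x y \<noteq> 0 \<or> homogeneous_eval d q x y \<noteq> 0"
proof (cases "y = 0")
  case True
  then show ?thesis using assms coprime_coeff_max_nz[OF assms(1)] by (auto simp: homogeneous_eval_0)
next
  case False
  then show ?thesis using assms coprime_poly_0[OF assms(1)] by (auto simp: homogeneous_eval_nonzero)
qed

lemma quotient_map_sphere_point:
  assumes "d = max (degree p) (degree q)" "x \<noteq> 0 \<or> y \<noteq> 0"
  shows "quotient_map_of_polys p q (sphere_point x y) =
     sphere_point (homogeneous_eval d p x y) (homogeneous_eval d q x y)"
proof (cases "y = 0")
  case True
  then have "x ^ d \<noteq> 0" using assms by simp
  then have "sphere_point (coeff p d * x ^ d) (coeff q d * x ^ d) = sphere_point (coeff p d) (coeff q d)"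
    by (metis mult.commute sphere_point_scale)
  moreover have "sphere_point x y = None" using True by (simp add: sphere_point_def)
  ultimately show ?thesis using True assms(1) by (simp add: homogeneous_eval_0 quotient_map_None)
next
  case False
  then show ?thesis using assms
    by (simp add: homogeneous_eval_nonzero quotient_map_Some sphere_point_def[of x y] sphere_point_scale)
qed

lemma poly_homogeneous_compose:
  "poly (homogeneous_compose d p g h) z = homogeneous_eval d p (poly g z) (poly h z)"
  by (simp add: homogeneous_compose_def homogeneous_eval_def poly_sum mult_ac)

text \<open>Stated for bounds rather than exact degrees: the value of a rational map at infinity is
  read off from coefficients of a common formal degree, one of which may be zero.\<close>

lemma coeff_mult_bound:
  fixes p q :: "'a::comm_semiring_0 poly"
  assumes "degree p \<le> m" "degree q \<le> n"
  shows "coeff (p * q) (m + n) = coeff p m * coeff q n"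
proof -
  have "coeff (p * q) (m + n) = (\<Sum>i\<le>m + n. if i = m then coeff p m * coeff q n else 0)"
    unfolding coeff_mult
  proof (rule sum.cong)
    fix i assume "i \<in> {..m + n}"
    consider "i < m" | "i = m" | "i > m" by linarith
    then show "coeff p i * coeff q (m + n - i) = (if i = m then coeff p m * coeff q n else 0)"
      by cases (use assms in \<open>auto simp: coeff_eq_0\<close>)
  qed simp
  then show ?thesis by simp
qed

lemma coeff_power_bound:
  fixes p :: "'a::comm_semiring_1 poly"
  assumes "degree p \<le> m"
  shows "coeff (p ^ i) (i * m) = coeff p m ^ i"
proof (induction i)
  case (Suc i)
  have "degree (p ^ i) \<le> i * m"
    using degree_power_le[of p i] assms by (metis le_trans mult.commute mult_le_mono1)
  then show ?case using coeff_mult_bound[OF assms] Suc by simp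
qed simp

lemma homogeneous_compose_degree:
  assumes "degree g \<le> e" "degree h \<le> e"
  shows "degree (homogeneous_compose d p g h) \<le> d * e"
    and "coeff (homogeneous_compose d p g h) (d * e) = homogeneous_eval d p (coeff g e) (coeff h e)"
proof -
  have deg: "degree (g ^ i) \<le> i * e" "degree (h ^ i) \<le> i * e" for i
    using degree_power_le[of g i] degree_power_le[of h i] assms
    by (metis le_trans mult.commute mult_le_mono1)+
  have split: "i * e + (d - i) * e = d * e" if "i \<le> d" for i
    using that by (simp flip: add_mult_distrib)
  show "degree (homogeneous_compose d p g h) \<le> d * e"
    unfolding homogeneous_compose_def
  proof (rule degree_sum_le)
    fix i assume "i \<in> {..d}"
    then have "degree (g ^ i * h ^ (d - i)) \<le> d * e"
      using degree_mult_le[of "g ^ i" "h ^ (d - i)"] deg(1)[of i] deg(2)[of "d - i"] split[of i] by simp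
    then show "degree (smult (coeff p i) (g ^ i * h ^ (d - i))) \<le> d * e"
      using degree_smult_le le_trans by blast
  qed simp
  have "coeff (g ^ i * h ^ (d - i)) (d * e) = coeff g e ^ i * coeff h e ^ (d - i)" if "i \<le> d" for i
    using coeff_mult_bound[OF deg(1)[of i] deg(2)[of "d - i"]] split[OF that]
    by (simp add: coeff_power_bound assms)
  then show "coeff (homogeneous_compose d p g h) (d * e) = homogeneous_eval d p (coeff g e) (coeff h e)"
    by (simp add: homogeneous_compose_def homogeneous_eval_def coeff_sum mult.assoc)
qed

lemma coprime_if_no_common_zero:
  fixes p q :: "complex poly"
  assumes "p \<noteq> 0 \<or> q \<noteq> 0" "\<And>z. poly p z \<noteq> 0 \<or> poly q z \<noteq> 0"
  shows "coprime p q"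
proof (rule coprimeI)
  fix r assume r: "r dvd p" "r dvd q"
  then have "r \<noteq> 0" using assms(1) by auto
  moreover have "degree r = 0"
  proof (rule ccontr)
    assume "degree r \<noteq> 0"
    then obtain z where "poly r z = 0"
      using fundamental_theorem_of_algebra[of r] by (auto simp: constant_degree)
    then show False using r assms(2)[of z] by (auto elim!: dvdE)
  qed
  ultimately show "is_unit r" by (simp add: is_unit_iff_degree)
qed

text \<open>Composition is substitution of forms. The inner pair never takes the value (0, 0) and
  the outer forms have no other common zero, so nothing cancels at finite points or at infinity;
  hence the new pair is coprime and the degree is exactly multiplicative.\<close>

lemma represents_compose:
  assumes "represents_rational a b f" "represents_rational g h u"
    and "rational_degree f \<ge> 1" "rational_degree u \<ge> 1"
  shows "represents_rational (homogeneous_compose (rational_degree f) a g h)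
           (homogeneous_compose (rational_degree f) b g h) (f \<circ> u)" (is "represents_rational ?P ?Q _")
    and "rational_degree (f \<circ> u) = rational_degree f * rational_degree u"
proof -
  define d where "d = rational_degree f"
  define e where "e = rational_degree u"
  have d: "d = max (degree a) (degree b)" and e: "e = max (degree g) (degree h)"
    using rational_degree_eq assms(1,2) by (auto simp: d_def e_def)
  have cop: "coprime a b" "coprime g h" and f: "f = quotient_map_of_polys a b"
    and u: "u = quotient_map_of_polys g h"
    using assms(1,2) by (auto simp: represents_rational_def)
  have nz: "poly ?P z \<noteq> 0 \<or> poly ?Q z \<noteq> 0" for z
    unfolding poly_homogeneous_compose
    by (rule homogeneous_eval_no_common_zero[OF cop(1)]) (use coprime_poly_0[OF cop(2)] d in \<open>auto simp: d_def\<close>)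
  have P: "degree ?P \<le> d * e" "coeff ?P (d * e) = homogeneous_eval d a (coeff g e) (coeff h e)"
    and Q: "degree ?Q \<le> d * e" "coeff ?Q (d * e) = homogeneous_eval d b (coeff g e) (coeff h e)"
    using homogeneous_compose_degree[of g e h d] e by (auto simp: d_def)
  have gh: "coeff g e \<noteq> 0 \<or> coeff h e \<noteq> 0" using coprime_coeff_max_nz[OF cop(2)] e by simp
  \<comment> \<open>Absence of cancellation at infinity: the coefficients of index
    \<open>d * e\<close> are the outer forms at the coordinates of the inner value at
    infinity.\<close>
  have top: "coeff ?P (d * e) \<noteq> 0 \<or> coeff ?Q (d * e) \<noteq> 0"
    unfolding P Q by (rule homogeneous_eval_no_common_zero[OF cop(1) d gh])
  then have deg: "max (degree ?P) (degree ?Q) = d * e"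
    using P(1) Q(1) le_degree[of ?P "d * e"] le_degree[of ?Q "d * e"] by linarith
  \<comment> \<open>If \<open>?Q\<close> were zero, \<open>?P\<close> would have degree
    \<open>d * e\<close> \<ge> 1, and any root of it would be a common zero.\<close>
  have "?Q \<noteq> 0"
  proof
    assume Q0: "?Q = 0"
    then have "degree ?P \<noteq> 0" using deg assms(3,4) by (auto simp: d_def e_def)
    then obtain z where "poly ?P z = 0"
      using fundamental_theorem_of_algebra[of ?P] by (auto simp: constant_degree)
    then show False using nz[of z] Q0 by simp
  qed
  moreover have "coprime ?P ?Q"
    by (rule coprime_if_no_common_zero) (use \<open>?Q \<noteq> 0\<close> nz in auto)
  moreover have "f \<circ> u = quotient_map_of_polys ?P ?Q"
  proof
    fix w
    show "(f \<circ> u) w = quotient_map_of_polys ?P ?Q w"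
    proof (cases w)
      case None
      have "(f \<circ> u) w = quotient_map_of_polys a b (sphere_point (coeff g e) (coeff h e))"
        by (simp add: None f u quotient_map_None e)
      also have "\<dots> = sphere_point (coeff ?P (d * e)) (coeff ?Q (d * e))"
        unfolding P Q by (rule quotient_map_sphere_point[OF d gh])
      finally show ?thesis by (simp add: None quotient_map_None deg)
    next
      case (Some z)
      have "(f \<circ> u) w = quotient_map_of_polys a b (sphere_point (poly g z) (poly h z))"
        by (simp add: Some f u quotient_map_Some)
      also have "\<dots> = sphere_point (poly ?P z) (poly ?Q z)"
        unfolding poly_homogeneous_compose d_def[symmetric]
        by (rule quotient_map_sphere_point[OF d]) (rule coprime_poly_0[OF cop(2)])
      finally show ?thesis by (simp add: Some quotient_map_Some)
    qed
  qed
  ultimately show rep: "represents_rational ?P ?Q (f \<circ> u)"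
    by (simp add: represents_rational_def)
  show "rational_degree (f \<circ> u) = rational_degree f * rational_degree u"
    using rational_degree_eq[OF rep] deg by (simp add: d_def e_def)
qed

section \<open>Equality and fibres of rational maps\<close>

lemma sphere_point_eq_cross:
  "sphere_point x y = sphere_point x' y' \<Longrightarrow> x * y' = x' * y"
  by (auto simp: sphere_point_def frac_eq_eq split: if_splits)

text \<open>Infinitely many agreements force the cross-multiplied polynomial identity. Coprimality
  then makes the two representing pairs proportional by a nonzero constant, so the maps agree at
  poles and at infinity too.\<close>

lemma rational_eq_if_infinite:
  assumes "represents_rational p q f" "represents_rational r s g"
    and "infinite {z. f (Some z) = g (Some z)}"
  shows "f = g"
proof -
  have "{z. f (Some z) = g (Some z)} \<subseteq> {z. poly (p * s - r * q) z = 0}"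
    using assms(1,2) by (auto simp: represents_rational_def quotient_map_Some dest: sphere_point_eq_cross)
  then have "infinite {z. poly (p * s - r * q) z = 0}"
    using assms(3) finite_subset by blast
  then have eq: "p * s = r * q" using poly_roots_finite[of "p * s - r * q"] by auto
  have cop: "coprime p q" "coprime r s" and nz: "q \<noteq> 0" "s \<noteq> 0"
    using assms(1,2) by (auto simp: represents_rational_def)
  have "q dvd s"
  proof -
    have "q dvd p * s" unfolding eq by simp
    with cop(1) show ?thesis
      by (subst (asm) coprime_dvd_mult_right_iff) (simp_all add: coprime_commute)
  qed
  moreover have "s dvd q"
  proof -
    have "s dvd r * q" unfolding eq[symmetric] by simp
    with cop(2) show ?thesis
      by (subst (asm) coprime_dvd_mult_right_iff) (simp_all add: coprime_commute)
  qed
  ultimately have "degree q = degree s"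
    using nz by (simp add: dvd_imp_degree_le le_antisym)
  from \<open>q dvd s\<close> obtain t where t: "s = q * t" by (elim dvdE)
  then have "degree t = 0" using nz \<open>degree q = degree s\<close> by (auto simp: degree_mult_eq)
  then obtain c where c: "t = [:c:]" by (rule degree_eq_zeroE)
  have c0: "c \<noteq> 0" using nz t c by auto
  have s: "s = smult c q" using t c by simp
  then have "r * q = smult c p * q" using eq by simp
  then have r: "r = smult c p" using mult_right_cancel[OF nz(1)] by blast
  have "quotient_map_of_polys p q w = quotient_map_of_polys r s w" for w
    by (cases w) (use c0 in \<open>auto simp: r s quotient_map_Some quotient_map_None sphere_point_scale\<close>)
  then show ?thesis using assms(1,2) by (auto simp: represents_rational_def)
qed

lemma rational_fibre_finite:
  assumes "represents_rational p q f" "rational_degree f \<ge> 1"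
  shows "finite {z. f (Some z) = w}"
proof (rule ccontr)
  assume inf: "infinite {z. f (Some z) = w}"
  have deg: "max (degree p) (degree q) \<ge> 1" using rational_degree_eq[OF assms(1)] assms(2) by simp
  have f: "f = quotient_map_of_polys p q" "q \<noteq> 0" "coprime p q"
    using assms by (auto simp: represents_rational_def)
  show False
  proof (cases w)
    case None
    then have "{z. f (Some z) = w} \<subseteq> {z. poly q z = 0}"
      by (auto simp: f quotient_map_Some sphere_point_def split: if_splits)
    then show False using inf poly_roots_finite[OF f(2)] finite_subset by blast
  next
    case (Some v)
    then have "{z. f (Some z) = w} \<subseteq> {z. poly (p - smult v q) z = 0}"
      by (auto simp: f quotient_map_Some sphere_point_def split: if_splits)
    then have "p - smult v q = 0"
      using inf poly_roots_finite[of "p - smult v q"] finite_subset by blast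
    then have p: "p = smult v q" by simp
    then have "is_unit q" using f(3) coprime_common_divisor[of p q q] by (simp add: dvd_smult)
    then have "degree q = 0" using f(2) by (simp add: is_unit_iff_degree)
    moreover have "degree p = 0" using p \<open>degree q = 0\<close> by simp
    ultimately show False using deg by simp
  qed
qed


section \<open>Blaschke products as quotients of polynomials\<close>

text \<open>A finite Blaschke product p/q without division. The strict inequality keeps zeros of
  \<open>q\<close> out of the open disc, coprimality keeps them off the circle, and strictness
  inside against equality on the circle rules out constants.\<close>

definition inner_pair :: "complex poly \<Rightarrow> complex poly \<Rightarrow> bool" where
  "inner_pair p q \<longleftrightarrow> coprime p q \<and>
     (\<forall>z. norm z < 1 \<longrightarrow> norm (poly p z) < norm (poly q z)) \<and>
     (\<forall>z. norm z = 1 \<longrightarrow> norm (poly p z) = norm (poly q z))"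

section \<open>Reflection of polynomials in the unit circle\<close>

definition conj_reflect :: "nat \<Rightarrow> complex poly \<Rightarrow> complex poly" where
  "conj_reflect n p = (\<Sum>i\<le>n. monom (cnj (coeff p (n - i))) i)"

lemma coeff_conj_reflect: "coeff (conj_reflect n p) i = (if i \<le> n then cnj (coeff p (n - i)) else 0)"
  by (simp add: conj_reflect_def coeff_sum)

text \<open>Reversing and conjugating the coefficients corresponds to the reflection of the plane
  sending z to 1 / conj z. Since that map fixes the circle pointwise, conjugates of values on the
  circle become polynomial expressions.\<close>

lemma poly_conj_reflect:
  assumes "z \<noteq> 0" "degree p \<le> n"
  shows "poly (conj_reflect n p) z = z ^ n * cnj (poly p (1 / cnj z))"
proof -
  have "poly (conj_reflect n p) z = (\<Sum>i\<le>n. cnj (coeff p (n - i)) * z ^ i)"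
    by (simp add: conj_reflect_def poly_sum poly_monom)
  also have "\<dots> = (\<Sum>i\<le>n. cnj (coeff p i) * z ^ (n - i))"
    by (rule sum.reindex_bij_witness[of _ "\<lambda>i. n - i" "\<lambda>i. n - i"]) auto
  also have "\<dots> = (\<Sum>i\<le>n. z ^ n * (cnj (coeff p i) * (1 / z) ^ i))"
    by (rule sum.cong) (use assms in \<open>auto simp: power_diff power_divide\<close>)
  also have "\<dots> = z ^ n * cnj (\<Sum>i\<le>n. coeff p i * (1 / cnj z) ^ i)"
    by (simp add: sum_distrib_left)
  also have "(\<Sum>i\<le>n. coeff p i * (1 / cnj z) ^ i) = poly p (1 / cnj z)"
    unfolding poly_altdef by (rule sum.mono_neutral_right) (use assms in \<open>auto simp: coeff_eq_0\<close>)
  finally show ?thesis .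
qed

lemma infinite_unit_circle: "infinite (sphere 0 1 :: complex set)"
proof
  assume "finite (sphere 0 1 :: complex set)"
  then obtain a where "sphere 0 1 = {a::complex}"
    using connected_finite_iff_sing[OF connected_sphere[of "0::complex" 1]] by auto
  then have "(1::complex) = - 1" by (metis dist_0_norm mem_sphere norm_minus_cancel norm_one singletonD)
  then show False by simp
qed

lemma unit_inverse_cnj: "norm z = 1 \<Longrightarrow> 1 / cnj z = z"
  by (subst complex_div_cnj) simp

lemma inner_pair_nz:
  assumes "inner_pair p q" shows "p \<noteq> 0" "q \<noteq> 0"
proof -
  show q: "q \<noteq> 0" using assms by (auto simp: inner_pair_def dest: spec[of _ 0])
  show "p \<noteq> 0"
  proof
    assume p: "p = 0"
    then have "poly q 1 = 0" using assms by (auto simp: inner_pair_def dest: spec[of _ 1])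
    then show False using assms p coprime_poly_0[of p q 1] by (auto simp: inner_pair_def)
  qed
qed

text \<open>A finite Blaschke product is its own reflection in the unit circle.\<close>

lemma inner_pair_reflect:
  assumes "inner_pair p q"
  obtains c where "degree q \<le> degree p" "degree p \<ge> 1" "norm c = 1"
    "conj_reflect (degree p) p = smult c q" "conj_reflect (degree p) q = smult c p"
    "norm (coeff q (degree p)) < norm (lead_coeff p)"
proof -
  \<comment> \<open>Both polynomials are reflected at the same formal degree; that it equals
    \<open>degree p\<close> emerges only at the end.\<close>
  define n where "n = max (degree p) (degree q)"
  have n: "degree p \<le> n" "degree q \<le> n" by (auto simp: n_def)
  have cop: "coprime p q" and T: "\<And>z. norm z = 1 \<Longrightarrow> norm (poly p z) = norm (poly q z)"
    and D: "norm (poly p 0) < norm (poly q 0)"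
    using assms by (auto simp: inner_pair_def)
  have nz: "p \<noteq> 0" "q \<noteq> 0" using inner_pair_nz[OF assms] by auto
  let ?p = "conj_reflect n p" and ?q = "conj_reflect n q"
  \<comment> \<open>On the circle the product of a polynomial and its reflection is z^n times its
    squared modulus, so equality of the moduli becomes a polynomial identity with infinitely many
    solutions.\<close>
  have "poly (p * ?p - q * ?q) z = 0" if "z \<in> sphere 0 1" for z
  proof -
    have z: "norm z = 1" "z \<noteq> 0" "1 / cnj z = z" using that unit_inverse_cnj by auto
    have "poly p z * cnj (poly p z) = poly q z * cnj (poly q z)"
      using T[OF z(1)] by (simp flip: complex_norm_square)
    then have "z ^ n * (poly p z * cnj (poly p z)) = z ^ n * (poly q z * cnj (poly q z))" by simp
    then show ?thesis using z(2,3) n by (simp add: poly_conj_reflect mult_ac)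
  qed
  then have "sphere 0 1 \<subseteq> {z. poly (p * ?p - q * ?q) z = 0}" by auto
  then have "infinite {z. poly (p * ?p - q * ?q) z = 0}"
    using infinite_unit_circle finite_subset by blast
  then have eq: "p * ?p = q * ?q" using poly_roots_finite[of "p * ?p - q * ?q"] by auto
  have "p dvd ?q"
  proof -
    have "p dvd q * ?q" unfolding eq[symmetric] by simp
    with cop show ?thesis by (subst (asm) coprime_dvd_mult_right_iff) simp_all
  qed
  then obtain e where e: "?q = p * e" by (elim dvdE)
  have "p * ?p = p * (e * q)" using eq e by (simp add: mult_ac)
  then have e': "?p = e * q" using mult_left_cancel[OF nz(1)] by blast
  have "e \<noteq> 0"
  proof
    assume "e = 0"
    then have "coeff ?q i = 0" for i using e by simp
    then have "coeff q (n - i) = 0" if "i \<le> n" for i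
      using that by (metis coeff_conj_reflect complex_cnj_zero_iff)
    then have "coeff q (degree q) = 0" using n(2) by (metis diff_diff_cancel diff_le_self)
    then show False using nz by simp
  qed
  have deg: "degree (conj_reflect n r) \<le> n" for r
    by (rule degree_le) (simp add: coeff_conj_reflect)
  \<comment> \<open>The reflections have degree at most \<open>n\<close>, while \<open>n\<close> is
    already attained by \<open>p\<close> or \<open>q\<close>; this leaves no room for a nonconstant
    cofactor \<open>e\<close>.\<close>
  have "degree e + max (degree p) (degree q) \<le> n"
    using deg[of p] deg[of q] e e' nz \<open>e \<noteq> 0\<close> by (simp add: degree_mult_eq)
  then have "degree e = 0" by (simp add: n_def)
  then obtain c where c: "e = [:c:]" by (rule degree_eq_zeroE)
  have q0: "coeff q 0 \<noteq> 0" and pq0: "norm (coeff p 0) < norm (coeff q 0)"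
    using D by (auto simp: poly_0_coeff_0)
  have r: "?q = smult c p" "?p = smult c q" using e e' c by auto
  have "cnj (coeff q (n - i)) = c * coeff p i" "cnj (coeff p (n - i)) = c * coeff q i" if "i \<le> n" for i
    using arg_cong[OF r(1), of "\<lambda>p. coeff p i"] arg_cong[OF r(2), of "\<lambda>p. coeff p i"] that
    by (auto simp: coeff_conj_reflect)
  \<comment> \<open>The extreme coefficients give |q_0| = |c|^2 |q_0|, hence |c| = 1, and then |p_n|
    = |q_0| > |p_0| = |q_n|. In particular \<open>p\<close> has degree \<open>n\<close>.\<close>
  from this[of n] this[of 0] have cc: "cnj (coeff q 0) = c * coeff p n" "cnj (coeff p n) = c * coeff q 0"
     "cnj (coeff p 0) = c * coeff q n" by auto
  have "norm (coeff q 0) = norm c * (norm c * norm (coeff q 0))"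
    using cc(1,2) by (metis complex_mod_cnj norm_mult)
  then have "norm c * norm c = 1" using q0 by simp
  then have nc: "norm c = 1" using power2_eq_1_iff[of "norm c"] norm_ge_zero[of c] by (auto simp: power2_eq_square simp del: norm_ge_zero)
  then have norms: "norm (coeff q n) = norm (coeff p 0)" "norm (coeff p n) = norm (coeff q 0)"
    using arg_cong[OF cc(3), of norm] arg_cong[OF cc(1), of norm] by (auto simp: norm_mult)
  have "coeff p n \<noteq> 0" using norms q0 by auto
  then have np: "n = degree p" using n(1) le_degree[of p n] by simp
  have "n \<noteq> 0"
  proof
    assume "n = 0"
    then obtain a b where "p = [:a:]" "q = [:b:]" using n by (metis degree_eq_zeroE le_zero_eq)
    then show False using T[of 1] D by simp
  qed
  then show ?thesis using that[of c] np n r nc norms pq0 by simp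
qed

text \<open>Reflection carries the exterior into the disc and exchanges \<open>p\<close> and
  \<open>q\<close> up to a unimodular constant, so the inequality in the disc is reversed
  outside.\<close>

lemma inner_pair_outside:
  assumes "inner_pair p q" "norm z > 1"
  shows "norm (poly q z) < norm (poly p z)"
proof -
  obtain c where c: "degree q \<le> degree p" "norm c = 1"
    "conj_reflect (degree p) p = smult c q" "conj_reflect (degree p) q = smult c p"
    using inner_pair_reflect[OF assms(1)] by metis
  have z0: "z \<noteq> 0" using assms by auto
  let ?w = "1 / cnj z"
  have "norm ?w < 1" using assms(2) by (simp add: norm_divide divide_simps)
  then have "norm (poly p ?w) < norm (poly q ?w)" using assms(1) by (simp add: inner_pair_def)
  moreover have "norm (poly q z) = norm (z ^ degree p * cnj (poly p ?w))"
    using arg_cong[OF poly_conj_reflect[OF z0, of p "degree p"], of norm] c by (simp add: norm_mult)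
  moreover have "norm (poly p z) = norm (z ^ degree p * cnj (poly q ?w))"
    using arg_cong[OF poly_conj_reflect[OF z0 c(1)], of norm] c by (simp add: norm_mult)
  ultimately show ?thesis using z0 by (simp add: norm_mult)
qed

lemma inner_pair_represents:
  "inner_pair p q \<Longrightarrow> represents_rational p q (quotient_map_of_polys p q)"
  using inner_pair_nz by (simp add: represents_rational_def inner_pair_def)

lemma inner_pair_circle_nz:
  assumes "inner_pair p q" "norm z \<le> 1" shows "poly q z \<noteq> 0"
proof (cases "norm z = 1")
  case True
  then show ?thesis using assms coprime_poly_0[of p q z] by (auto simp: inner_pair_def)
next
  case False
  then have "norm (poly p z) < norm (poly q z)" using assms by (simp add: inner_pair_def)
  then show ?thesis by auto
qed

lemma inner_pair_degree:
  "inner_pair p q \<Longrightarrow> rational_degree (quotient_map_of_polys p q) = degree p"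
  using rational_degree_eq[OF inner_pair_represents] inner_pair_reflect by (metis max.absorb1)

section \<open>Preimages of the disc and the circle\<close>

lemma sphere_point_disc: "sphere_point x y \<in> unit_disc \<longleftrightarrow> norm x < norm y"
  by (auto simp: sphere_point_def norm_divide inj_image_mem_iff divide_simps)

lemma sphere_point_circle:
  "x \<noteq> 0 \<or> y \<noteq> 0 \<Longrightarrow> sphere_point x y \<in> Some ` sphere 0 1 \<longleftrightarrow> norm x = norm y"
  by (auto simp: sphere_point_def norm_divide inj_image_mem_iff divide_simps)

text \<open>Disc, circle and exterior (with infinity) are each mapped into themselves, and they
  partition the sphere, so each is its own full preimage. The leading coefficients settle the point
  at infinity.\<close>

lemma inner_pair_disc_circle:
  assumes "inner_pair p q" "f = quotient_map_of_polys p q"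
  shows "f w \<in> unit_disc \<longleftrightarrow> w \<in> unit_disc" and "f w \<in> Some ` sphere 0 1 \<longleftrightarrow> w \<in> Some ` sphere 0 1"
proof -
  have cop: "coprime p q" using assms by (simp add: inner_pair_def)
  have c: "degree q \<le> degree p" "norm (coeff q (degree p)) < norm (lead_coeff p)"
    using inner_pair_reflect[OF assms(1)] by metis+
  have "(f w \<in> unit_disc \<longleftrightarrow> w \<in> unit_disc) \<and> (f w \<in> Some ` sphere 0 1 \<longleftrightarrow> w \<in> Some ` sphere 0 1)"
  proof (cases w)
    case None
    have "f w = sphere_point (lead_coeff p) (coeff q (degree p))"
      using c by (simp add: assms None quotient_map_None max.absorb1)
    moreover have "lead_coeff p \<noteq> 0" using c(2) by auto
    ultimately have "f w \<notin> unit_disc" "f w \<notin> Some ` sphere 0 1"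
      using c(2) sphere_point_circle[of "lead_coeff p" "coeff q (degree p)"]
        sphere_point_disc[of "lead_coeff p" "coeff q (degree p)"] by simp_all
    then show ?thesis using None by auto
  next
    case (Some z)
    have f: "f w = sphere_point (poly p z) (poly q z)" by (simp add: assms Some quotient_map_Some)
    have nz: "poly p z \<noteq> 0 \<or> poly q z \<noteq> 0" using coprime_poly_0[OF cop] .
    have 1: "f w \<in> unit_disc \<longleftrightarrow> norm (poly p z) < norm (poly q z)"
      and 2: "f w \<in> Some ` sphere 0 1 \<longleftrightarrow> norm (poly p z) = norm (poly q z)"
      and 3: "w \<in> unit_disc \<longleftrightarrow> norm z < 1" and 4: "w \<in> Some ` sphere 0 1 \<longleftrightarrow> norm z = 1"
      unfolding f sphere_point_disc sphere_point_circle[OF nz] by (auto simp: Some)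
    consider "norm z < 1" | "norm z = 1" | "norm z > 1" by linarith
    then show ?thesis
      unfolding 1 2 3 4
      by cases (use assms(1) inner_pair_outside[OF assms(1), of z] in \<open>auto simp: inner_pair_def\<close>)
  qed
  then show "f w \<in> unit_disc \<longleftrightarrow> w \<in> unit_disc" "f w \<in> Some ` sphere 0 1 \<longleftrightarrow> w \<in> Some ` sphere 0 1"
    by auto
qed

text \<open>Solve p = v q by the fundamental theorem of algebra: the top coefficient survives
  because |q_n| < |p_n| and |v| \<le> 1. Full invariance then places the solution in the closed
  disc.\<close>

lemma inner_pair_surj:
  assumes "inner_pair p q" "norm v \<le> 1"
  shows "\<exists>z. norm z \<le> 1 \<and> quotient_map_of_polys p q (Some z) = Some v"
proof -
  have c: "degree q \<le> degree p" "degree p \<ge> 1" "norm (coeff q (degree p)) < norm (lead_coeff p)"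
    using inner_pair_reflect[OF assms(1)] by metis+
  have "coeff (p - smult v q) (degree p) \<noteq> 0"
  proof
    assume "coeff (p - smult v q) (degree p) = 0"
    then have "norm (lead_coeff p) = norm v * norm (coeff q (degree p))" by (simp add: norm_mult)
    also have "\<dots> \<le> norm (coeff q (degree p))" using assms(2) by (simp add: mult_left_le_one_le)
    finally show False using c by simp
  qed
  then have "degree (p - smult v q) \<noteq> 0" using c(2) le_degree[of "p - smult v q" "degree p"] by simp
  then obtain z where z: "poly (p - smult v q) z = 0"
    using fundamental_theorem_of_algebra[of "p - smult v q"] by (auto simp: constant_degree)
  have "poly q z \<noteq> 0"
    using z coprime_poly_0[of p q z] assms(1) by (auto simp: inner_pair_def)
  then have v: "quotient_map_of_polys p q (Some z) = Some v"
    using z by (simp add: quotient_map_Some sphere_point_def field_simps)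
  have "Some v \<in> unit_disc \<or> Some v \<in> Some ` sphere 0 1" using assms(2) by (auto simp: image_iff)
  then have "Some z \<in> unit_disc \<or> Some z \<in> Some ` sphere 0 1"
    using inner_pair_disc_circle[OF assms(1) refl, of "Some z"] v by simp
  then show ?thesis using v by (intro exI[of _ z]) (auto simp: image_iff)
qed

section \<open>Properness on the disc and boundary values\<close>

lemma homeomorphic_map_Some_disc:
  "homeomorphic_map (top_of_set (ball 0 1)) (subtopology riemann_sphere unit_disc) Some"
proof -
  have "embedding_map euclidean riemann_sphere (Some :: complex \<Rightarrow> _)" by (rule embedding_map_Some)
  then have "homeomorphic_map euclidean (subtopology riemann_sphere (range Some)) (Some :: complex \<Rightarrow> _)"
    by (simp add: embedding_map_def)
  then have "homeomorphic_map (subtopology euclidean (ball 0 1))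
      (subtopology (subtopology riemann_sphere (range Some)) unit_disc) (Some :: complex \<Rightarrow> _)"
    by (rule homeomorphic_map_subtopologies) auto
  moreover have "range Some \<inter> unit_disc = unit_disc" by auto
  ultimately show ?thesis by (simp add: subtopology_subtopology)
qed

lemma proper_map_cong:
  assumes "\<And>x. x \<in> topspace X \<Longrightarrow> f x = g x"
  shows "proper_map X Y f \<longleftrightarrow> proper_map X Y g"
proof -
  have "f ` U = g ` U" if "closedin X U" for U
    by (rule image_cong) (use assms closedin_subset[OF that] in auto)
  moreover have "{x \<in> topspace X. f x = y} = {x \<in> topspace X. g x = y}" for y
    using assms by auto
  ultimately show ?thesis by (simp add: proper_map_def closed_map_def)
qed

lemma proper_map_disc_iff:
  assumes "\<And>z. norm z < 1 \<Longrightarrow> f (Some z) = Some (g z)"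
  shows "proper_map (subtopology riemann_sphere unit_disc) (subtopology riemann_sphere unit_disc) f \<longleftrightarrow>
    proper_map (top_of_set (ball 0 1)) (top_of_set (ball 0 1)) g"
proof -
  let ?X = "top_of_set (ball (0::complex) 1)" and ?Y = "subtopology riemann_sphere unit_disc"
  have topY: "topspace ?Y = unit_disc" by auto
  have S: "homeomorphic_map ?X ?Y Some" by (rule homeomorphic_map_Some_disc)
  have Sp: "proper_map ?X ?Y Some" and Sc: "continuous_map ?X ?Y Some" and Si: "Some ` topspace ?X = topspace ?Y"
    using S by (auto simp: homeomorphic_imp_proper_map homeomorphic_imp_continuous_map)
  have eq: "proper_map ?X ?Y (f \<circ> Some) \<longleftrightarrow> proper_map ?X ?Y (Some \<circ> g)"
    by (rule proper_map_cong) (use assms in auto)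
  show ?thesis
  proof
    assume f: "proper_map ?Y ?Y f"
    show "proper_map ?X ?X g"
    proof (rule proper_map_from_composition_right_inj)
      show "proper_map ?X ?Y (Some \<circ> g)" using proper_map_compose[OF Sp f] eq by simp
      show "g \<in> topspace ?X \<rightarrow> topspace ?X"
      proof
        fix z assume z: "z \<in> topspace ?X"
        then have "f (Some z) \<in> unit_disc" using proper_map_imp_subset_topspace[OF f] topY by auto
        then show "g z \<in> topspace ?X" using z assms by auto
      qed
    qed (use Sc in auto)
  next
    assume "proper_map ?X ?X g"
    then have "proper_map ?X ?Y (f \<circ> Some)" using proper_map_compose Sp eq by blast
    then show "proper_map ?Y ?Y f" using Sc Si by (rule proper_map_from_composition_left)
  qed
qed

text \<open>Continuity gives |p| \<le> |q| on the circle. Strict inequality at a boundary point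
  would bound |p/q| by some s < 1 on nearby disc points, which would then lie in the preimage of a
  compact set; properness keeps that preimage compactly inside the disc.\<close>

lemma blaschke_imp_inner_pair:
  assumes "blaschke_product f"
  shows "\<exists>p q. inner_pair p q \<and> f = quotient_map_of_polys p q"
proof -
  obtain p q where rep: "represents_rational p q f"
    and img: "f ` unit_disc = unit_disc"
    and pm: "proper_map (subtopology riemann_sphere unit_disc) (subtopology riemann_sphere unit_disc) f"
    using assms by (auto simp: blaschke_product_def rational_map_def)
  have cop: "coprime p q" and f: "f = quotient_map_of_polys p q"
    using rep by (auto simp: represents_rational_def)
  have D: "norm (poly p z) < norm (poly q z)" if "norm z < 1" for z
  proof -
    have "f (Some z) \<in> unit_disc" using img that by auto
    then show ?thesis by (simp add: f quotient_map_Some sphere_point_disc)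
  qed
  define g where "g z = poly p z / poly q z" for z
  have fg: "f (Some z) = Some (g z)" if "norm z < 1" for z
    using D[OF that] by (auto simp: f quotient_map_Some sphere_point_def g_def)
  have propg: "proper_map (top_of_set (ball 0 1)) (top_of_set (ball 0 1)) g"
    using pm proper_map_disc_iff[of f g] fg by blast
  have "norm (poly p z) = norm (poly q z)" if z: "norm z = 1" for z
  proof (rule antisym)
    have cb: "z \<in> closure (ball 0 1)" using z by simp
    have "closed {z. norm (poly p z) \<le> norm (poly q z)}"
      by (intro closed_Collect_le continuous_intros)
    moreover have "ball 0 1 \<subseteq> {z. norm (poly p z) \<le> norm (poly q z)}" using D by (auto intro: less_imp_le)
    ultimately have "closure (ball 0 1) \<subseteq> {z. norm (poly p z) \<le> norm (poly q z)}"
      by (rule closure_minimal[rotated])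
    then show "norm (poly p z) \<le> norm (poly q z)" using cb by auto
    show "norm (poly q z) \<le> norm (poly p z)"
    proof (rule ccontr)
      assume "\<not> norm (poly q z) \<le> norm (poly p z)"
      then have lt: "norm (poly p z) < norm (poly q z)" by simp
      then have "norm (poly p z) / norm (poly q z) < 1" by (simp add: divide_simps)
      then obtain s where s: "norm (poly p z) / norm (poly q z) < s" "s < 1" using dense by blast
      define U where "U = {z. norm (poly p z) < s * norm (poly q z)}"
      have "open U" unfolding U_def by (intro open_Collect_less continuous_intros)
      moreover have "0 < norm (poly q z)" using lt norm_ge_zero[of "poly p z"] by linarith
      then have "z \<in> U" using s(1) by (simp add: U_def pos_divide_less_eq)
      \<comment> \<open>\<open>U\<close> is an open neighbourhood of \<open>z\<close>, so disc
        points of \<open>U\<close> accumulate at the boundary point \<open>z\<close>.\<close>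
      ultimately have zU: "z \<in> closure (U \<inter> ball 0 1)"
        using open_Int_closure_subset[of U "ball 0 1"] cb by auto
      define M where "M = {z \<in> ball 0 1. g z \<in> cball 0 s}"
      have "compactin (top_of_set (ball 0 1)) (cball 0 s :: complex set)"
        using s by (auto simp: compactin_subtopology)
      from compactin_proper_map_preimage[OF propg this] have "compact M"
        by (simp add: M_def compactin_subtopology)
      moreover have "U \<inter> ball 0 1 \<subseteq> M"
      proof
        fix w assume w: "w \<in> U \<inter> ball 0 1"
        then have "norm (poly q w) > 0" using D[of w] norm_ge_zero[of "poly p w"] by auto
        then show "w \<in> M" using w by (simp add: M_def U_def g_def norm_divide pos_divide_le_eq)
      qed
      ultimately have "closure (U \<inter> ball 0 1) \<subseteq> M"
        by (intro closure_minimal) (auto intro: compact_imp_closed)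
      then show False using zU z by (auto simp: M_def)
    qed
  qed
  then have "inner_pair p q" using cop D by (simp add: inner_pair_def)
  with f show ?thesis by blast
qed

text \<open>The quotient is continuous on the closed disc and unimodular on the circle. The preimage
  in the closed disc of a compact subset of the open disc is therefore compact and misses the
  circle.\<close>

lemma inner_pair_imp_blaschke:
  assumes "inner_pair p q"
  shows "blaschke_product (quotient_map_of_polys p q)" (is "blaschke_product ?f")
proof -
  define g where "g z = poly p z / poly q z" for z
  have q0: "poly q z \<noteq> 0" if "norm z \<le> 1" for z using inner_pair_circle_nz[OF assms that] .
  have fg: "?f (Some z) = Some (g z)" if "norm z < 1" for z
    using q0[of z] that by (simp add: quotient_map_Some sphere_point_def g_def)
  have gD: "norm (g z) < 1" if "norm z < 1" for z
    using assms q0[of z] that by (simp add: g_def inner_pair_def norm_divide)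
  have cont: "continuous_on (cball 0 1) g"
    unfolding g_def by (intro continuous_intros) (use q0 in auto)
  have propg: "proper_map (top_of_set (ball 0 1)) (top_of_set (ball 0 1)) g"
  proof (rule compact_imp_proper_map)
    show "k_space (top_of_set (ball (0::complex) 1))"
      by (simp add: metrizable_imp_k_space metrizable_space_subtopology metrizable_space_euclidean)
    show "kc_space (top_of_set (ball (0::complex) 1))"
      by (simp add: Hausdorff_imp_kc_space Hausdorff_space_subtopology)
    show "g \<in> topspace (top_of_set (ball 0 1)) \<rightarrow> topspace (top_of_set (ball 0 1))"
      using gD by auto
    show "continuous_map (top_of_set (ball 0 1)) (top_of_set (ball 0 1)) g \<or> kc_space (top_of_set (ball (0::complex) 1))"
      by (simp add: Hausdorff_imp_kc_space Hausdorff_space_subtopology)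
    fix K :: "complex set" assume "compactin (top_of_set (ball 0 1)) K"
    then have K: "compact K" "K \<subseteq> ball 0 1" by (auto simp: compactin_subtopology)
    have "compact (cball 0 1 \<inter> g -` K)"
      using continuous_closed_preimage[OF cont closed_cball compact_imp_closed[OF K(1)]]
      by (auto simp: compact_eq_bounded_closed intro: bounded_subset[OF bounded_cball])
    moreover have "cball 0 1 \<inter> g -` K = {x \<in> topspace (top_of_set (ball 0 1)). g x \<in> K}"
    proof -
      have "norm x \<noteq> 1" if "g x \<in> K" for x
      proof
        assume x: "norm x = 1"
        then have "norm (g x) = 1" using assms q0[of x] by (simp add: g_def inner_pair_def norm_divide)
        then show False using that K(2) by auto
      qed
      then show ?thesis by (auto simp: less_le)
    qed
    ultimately show "compactin (top_of_set (ball 0 1)) {x \<in> topspace (top_of_set (ball 0 1)). g x \<in> K}"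
      by (auto simp: compactin_subtopology)
  qed
  have pm: "proper_map (subtopology riemann_sphere unit_disc) (subtopology riemann_sphere unit_disc) ?f"
    using propg proper_map_disc_iff[of ?f g] fg by blast
  have "?f ` unit_disc = unit_disc"
  proof
    show "?f ` unit_disc \<subseteq> unit_disc" using inner_pair_disc_circle(1)[OF assms refl] by blast
    show "unit_disc \<subseteq> ?f ` unit_disc"
    proof
      fix w :: "complex option" assume w: "w \<in> unit_disc"
      then obtain v where v: "w = Some v" "norm v < 1" by auto
      then obtain z where "?f (Some z) = w" using inner_pair_surj[OF assms, of v] by auto
      then show "w \<in> ?f ` unit_disc"
        using w inner_pair_disc_circle(1)[OF assms refl, of "Some z"] by blast
    qed
  qed
  moreover have "rational_degree ?f \<ge> 1"
    using inner_pair_degree[OF assms] inner_pair_reflect[OF assms] by metis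
  ultimately show ?thesis
    using inner_pair_represents[OF assms] pm by (auto simp: blaschke_product_def rational_map_def)
qed

lemma blaschke_disc_circle:
  assumes "blaschke_product f"
  shows "f w \<in> unit_disc \<longleftrightarrow> w \<in> unit_disc" "f w \<in> Some ` sphere 0 1 \<longleftrightarrow> w \<in> Some ` sphere 0 1"
proof -
  obtain p q where "inner_pair p q" "f = quotient_map_of_polys p q"
    using blaschke_imp_inner_pair[OF assms] by blast
  then show "f w \<in> unit_disc \<longleftrightarrow> w \<in> unit_disc" "f w \<in> Some ` sphere 0 1 \<longleftrightarrow> w \<in> Some ` sphere 0 1"
    by (simp_all only: inner_pair_disc_circle)
qed

text \<open>Surjectivity, properness and positive degree all follow from the behaviour on the disc
  and the circle, through \<open>inner_pair\<close>.\<close>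

lemma blaschkeI:
  assumes "represents_rational p q f"
    and "\<And>z. norm z < 1 \<Longrightarrow> f (Some z) \<in> unit_disc"
    and "\<And>z. norm z = 1 \<Longrightarrow> f (Some z) \<in> Some ` sphere 0 1"
  shows "blaschke_product f"
proof -
  have f: "coprime p q" "f = quotient_map_of_polys p q"
    using assms(1) by (auto simp: represents_rational_def)
  have "inner_pair p q"
    unfolding inner_pair_def
    using assms(2,3) f(1) sphere_point_circle[OF coprime_poly_0[OF f(1)]]
    by (simp add: f(2) quotient_map_Some sphere_point_disc)
  then show ?thesis using inner_pair_imp_blaschke f by blast
qed


section \<open>The argument of a Blaschke product on the circle\<close>

text \<open>On the circle \<open>cis t * cnj (cis t - a)\<close> equals 1 - conj(a) e^(it), so the
  last identity says that \<beta> is a continuous argument of the Blaschke factor (z - a) / (1 -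
  conj(a) z).\<close>

lemma blaschke_factor_argument:
  fixes a :: complex
  assumes "norm a < 1"
  obtains \<beta> :: "real \<Rightarrow> real" where "continuous_on UNIV \<beta>" "strict_mono \<beta>"
    "\<And>t. \<beta> (t + 2 * pi) = \<beta> t + 2 * pi"
    "\<And>t. cis t - a = cis (\<beta> t) * (cis t * cnj (cis t - a))"
proof -
  define u v where "u = Re a" and "v = Im a"
  \<comment> \<open>Here conj(a) e^(it) = X - iY. Thus 1 - conj(a) e^(it) has positive real part
    \<open>1 - X t\<close> and imaginary part \<open>Y t\<close>, and its argument is an arctan
    without branch jumps.\<close>
  define X Y where "X t = u * cos t + v * sin t" and "Y t = v * cos t - u * sin t" for t
  define \<beta> where "\<beta> t = t - 2 * arctan (Y t / (1 - X t))" for t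
  have XY: "(X t)\<^sup>2 + (Y t)\<^sup>2 = (norm a)\<^sup>2" for t
  proof -
    have "(X t)\<^sup>2 + (Y t)\<^sup>2 = (u\<^sup>2 + v\<^sup>2) * ((cos t)\<^sup>2 + (sin t)\<^sup>2)"
      by (simp add: X_def Y_def power2_eq_square algebra_simps del: sin_cos_squared_add sin_cos_squared_add2 sin_cos_squared_add3)
    then show ?thesis by (simp add: cmod_power2 u_def v_def)
  qed
  have na: "(norm a)\<^sup>2 < 1" using assms by (simp add: power_less_one_iff abs_square_less_1)
  have X1: "1 - X t > 0" for t
  proof -
    have "(X t)\<^sup>2 < 1" using XY[of t] na zero_le_power2[of "Y t"] by linarith
    then show ?thesis by (simp add: abs_square_less_1 abs_less_iff)
  qed
  \<comment> \<open>The derivative is the Poisson kernel (1 - |a|^2) / |1 - conj(a) e^(it)|^2, which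
    is positive.\<close>
  have deriv: "(\<beta> has_real_derivative (1 - (norm a)\<^sup>2) / ((1 - X t)\<^sup>2 + (Y t)\<^sup>2)) (at t)" for t
  proof -
    have dX: "(X has_real_derivative Y t) (at t)"
      unfolding X_def[abs_def] Y_def by (auto intro!: derivative_eq_intros)
    have dY: "(Y has_real_derivative - X t) (at t)"
      unfolding Y_def[abs_def] X_def by (auto intro!: derivative_eq_intros)
    have pos: "(1 - X t)\<^sup>2 + (Y t)\<^sup>2 > 0" using X1[of t] by (simp add: sum_power2_gt_zero_iff)
    have "((\<lambda>t. arctan (Y t / (1 - X t))) has_real_derivative
        inverse (1 + (Y t / (1 - X t))\<^sup>2) * ((- X t * (1 - X t) - Y t * (0 - Y t)) / ((1 - X t) * (1 - X t)))) (at t)"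
      by (rule DERIV_chain2[where g = "\<lambda>t. Y t / (1 - X t)", OF DERIV_arctan])
        (intro DERIV_divide dY DERIV_diff DERIV_const dX, use X1[of t] in simp)
    also have "inverse (1 + (Y t / (1 - X t))\<^sup>2) * ((- X t * (1 - X t) - Y t * (0 - Y t)) / ((1 - X t) * (1 - X t)))
      = ((norm a)\<^sup>2 - X t) / ((1 - X t)\<^sup>2 + (Y t)\<^sup>2)"
    proof -
      have "inverse (1 + (Y t / (1 - X t))\<^sup>2) = (1 - X t)\<^sup>2 / ((1 - X t)\<^sup>2 + (Y t)\<^sup>2)"
        using X1[of t] by (simp add: power_divide add_divide_eq_iff)
      moreover have "- X t * (1 - X t) - Y t * (0 - Y t) = (norm a)\<^sup>2 - X t"
        unfolding XY[of t, symmetric] by (simp add: power2_eq_square algebra_simps)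
      ultimately show ?thesis using X1[of t] by (simp add: power2_eq_square)
    qed
    finally have "(\<beta> has_real_derivative 1 - 2 * (((norm a)\<^sup>2 - X t) / ((1 - X t)\<^sup>2 + (Y t)\<^sup>2))) (at t)"
      unfolding \<beta>_def[abs_def] by (intro DERIV_diff DERIV_ident DERIV_cmult)
    also have "1 - 2 * (((norm a)\<^sup>2 - X t) / ((1 - X t)\<^sup>2 + (Y t)\<^sup>2)) = 
        (1 - (norm a)\<^sup>2) / ((1 - X t)\<^sup>2 + (Y t)\<^sup>2)"
    proof -
      have "(1 - X t)\<^sup>2 + (Y t)\<^sup>2 - 2 * ((norm a)\<^sup>2 - X t) = 1 - (norm a)\<^sup>2"
        unfolding XY[of t, symmetric] by (simp add: power2_eq_square algebra_simps)
      moreover have "1 - 2 * (M / Z) = N / Z" if "Z > 0" "Z - 2 * M = N" for M N Z :: real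
        using that by (auto simp: field_simps)
      ultimately show ?thesis using pos by blast
    qed
    finally show ?thesis .
  qed
  have pos: "(1 - (norm a)\<^sup>2) / ((1 - X t)\<^sup>2 + (Y t)\<^sup>2) > 0" for t
    using X1[of t] na by (simp add: sum_power2_gt_zero_iff)
  show ?thesis
  proof
    show "continuous_on UNIV \<beta>"
      using deriv DERIV_isCont by (auto simp: continuous_on_eq_continuous_at)
    show "strict_mono \<beta>"
      by (rule strict_monoI) (use DERIV_pos_imp_increasing deriv pos in blast)
    show "\<beta> (t + 2 * pi) = \<beta> t + 2 * pi" for t
      by (simp add: \<beta>_def X_def Y_def)
    show "cis t - a = cis (\<beta> t) * (cis t * cnj (cis t - a))" for t
    proof -
      define w where "w = 1 - cnj a * cis t"
      have w: "Re w = 1 - X t" "Im w = Y t"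
        by (auto simp: w_def X_def Y_def u_def v_def algebra_simps)
      have w0: "w \<noteq> 0" using w(1) X1[of t] by (metis less_irrefl zero_complex.simps(1))
      have "Arg w = arctan (Y t / (1 - X t))"
        using arg_conv_arctan[of w] w X1[of t] by simp
      then have b: "cis (\<beta> t) = cis t * (cis (- Arg w) * cis (- Arg w))"
        by (simp add: \<beta>_def cis_mult)
      have sg: "cis (- Arg w) * w = of_real (norm w)"
      proof -
        have "w = of_real (norm w) * cis (Arg w)" using w0 by (simp add: cis_Arg sgn_eq)
        then have "cis (- Arg w) * w = of_real (norm w) * (cis (- Arg w) * cis (Arg w))"
          by (metis mult.left_commute)
        then show ?thesis by (simp add: cis_mult)
      qed
      have "cnj w = cis (- Arg w) * of_real (norm w)"
        using arg_cong[OF rcis_cmod_Arg[of w], of cnj] by (simp add: rcis_def cis_cnj mult.commute)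
      then have "cnj w = cis (- Arg w) * (cis (- Arg w) * w)" using sg by simp
      moreover have "cis t * cnj (cis t) = 1" by (simp add: cis_cnj cis_mult)
      then have "cis t - a = cis t * cnj w" "cis t * cnj (cis t - a) = w"
        by (simp_all add: w_def algebra_simps)
      ultimately show ?thesis by (simp add: b mult_ac)
    qed
  qed
qed

text \<open>\<alpha> is an argument of the quotient of \<open>p\<close> by its reflection. Splitting
  off roots one at a time, each contributes a strictly increasing summand with increment 2 pi;
  strict growth can fail only for constants, where \<alpha> is constant.\<close>

lemma poly_circle_argument:
  fixes p :: "complex poly"
  assumes "p \<noteq> 0" "\<And>z. poly p z = 0 \<Longrightarrow> norm z < 1"
  shows "\<exists>\<alpha>::real \<Rightarrow> real. continuous_on UNIV \<alpha> \<and> mono \<alpha> \<and> (degree p \<ge> 1 \<longrightarrow> strict_mono \<alpha>) \<and>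
     (\<forall>t. \<alpha> (t + 2 * pi) = \<alpha> t + 2 * pi * degree p) \<and>
     (\<forall>t. poly p (cis t) = cis (\<alpha> t) * (cis t ^ degree p * cnj (poly p (cis t))))"
  using assms
proof (induction "degree p" arbitrary: p)
  case 0
  then obtain c where c: "p = [:c:]" "c \<noteq> 0" by (metis degree_eq_zeroE pCons_0_0)
  have "c = cis (2 * Arg c) * cnj c"
  proof -
    have "cis (2 * Arg c) * cnj c = of_real (norm c) * (cis (2 * Arg c) * cis (- Arg c))"
      using arg_cong[OF rcis_cmod_Arg[of c], of cnj] by (simp add: rcis_def cis_cnj mult_ac)
    also have "\<dots> = c" using rcis_cmod_Arg[of c] by (simp add: cis_mult rcis_def)
    finally show ?thesis by simp
  qed
  then show ?case using c by (intro exI[of _ "\<lambda>_. 2 * Arg c"]) (auto intro!: monoI)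
next
  case (Suc n)
  then obtain a where a: "poly p a = 0"
    using fundamental_theorem_of_algebra[of p] by (auto simp: constant_degree)
  then obtain p' where p': "p = [:- a, 1:] * p'" by (metis dvdE poly_eq_0_iff_dvd)
  have nz: "p' \<noteq> 0" using Suc.prems p' by auto
  have dg: "degree p = Suc (degree p')" using nz unfolding p' by (subst degree_mult_eq) simp_all
  then have "n = degree p'" using Suc.hyps(2) by simp
  from Suc.hyps(1)[OF this nz] Suc.prems(2) p'
  obtain \<alpha> where \<alpha>: "continuous_on UNIV \<alpha>" "mono \<alpha>" "\<And>t. \<alpha> (t + 2 * pi) = \<alpha> t + 2 * pi * degree p'"
     "\<And>t. poly p' (cis t) = cis (\<alpha> t) * (cis t ^ degree p' * cnj (poly p' (cis t)))"
    by auto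
  obtain \<beta> where \<beta>: "continuous_on UNIV \<beta>" "strict_mono \<beta>" "\<And>t. \<beta> (t + 2 * pi) = \<beta> t + 2 * pi"
     "\<And>t. cis t - a = cis (\<beta> t) * (cis t * cnj (cis t - a))"
    using blaschke_factor_argument Suc.prems(2)[OF a] by metis
  have sm: "strict_mono (\<lambda>t. \<alpha> t + \<beta> t)"
    using \<alpha>(2) \<beta>(2) by (intro strict_monoI) (simp add: add_le_less_mono monoD strict_monoD)
  have "poly p (cis t) = cis (\<alpha> t + \<beta> t) * (cis t ^ degree p * cnj (poly p (cis t)))" for t
  proof -
    have "poly p (cis t) = (cis t - a) * poly p' (cis t)" by (simp add: p' algebra_simps)
    also have "\<dots> = (cis (\<beta> t) * (cis t * cnj (cis t - a))) *
        (cis (\<alpha> t) * (cis t ^ degree p' * cnj (poly p' (cis t))))"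
      using \<alpha>(4)[of t] \<beta>(4)[of t] by (rule arg_cong2[of _ _ _ _ "(*)", rotated])
    also have "\<dots> = (cis (\<alpha> t) * cis (\<beta> t)) * (cis t ^ Suc (degree p') * cnj ((cis t - a) * poly p' (cis t)))"
      by (simp only: complex_cnj_mult power_Suc mult_ac)
    also have "(cis t - a) * poly p' (cis t) = poly p (cis t)" by (simp add: p' algebra_simps)
    finally show ?thesis by (simp add: dg cis_mult)
  qed
  moreover have "continuous_on UNIV (\<lambda>t. \<alpha> t + \<beta> t)" using \<alpha>(1) \<beta>(1) by (rule continuous_on_add)
  ultimately show ?case
    using sm strict_mono_mono[OF sm] \<alpha>(3) \<beta>(3)
    by (intro exI[of _ "\<lambda>t. \<alpha> t + \<beta> t"]) (auto simp: dg algebra_simps)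
qed

text \<open>All zeros of \<open>p\<close> lie in the disc and its reflection is \<open>c\<close>
  times \<open>q\<close> with |c| = 1, so p/q has the argument of the preceding lemma shifted by
  \<open>Arg c\<close>.\<close>

lemma inner_pair_circle_lift:
  assumes "inner_pair p q"
  obtains \<alpha> :: "real \<Rightarrow> real" where "continuous_on UNIV \<alpha>" "strict_mono \<alpha>"
    "\<And>t. \<alpha> (t + 2 * pi) = \<alpha> t + 2 * pi * degree p"
    "\<And>t. quotient_map_of_polys p q (Some (cis t)) = Some (cis (\<alpha> t))"
proof -
  obtain c where c: "degree p \<ge> 1" "norm c = 1" "conj_reflect (degree p) p = smult c q"
    using inner_pair_reflect[OF assms] by metis
  have "norm z < 1" if "poly p z = 0" for z
  proof (rule ccontr)
    assume "\<not> norm z < 1"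
    then have "norm (poly q z) \<le> norm (poly p z)"
      using assms inner_pair_outside[OF assms, of z] by (cases "norm z = 1") (auto simp: inner_pair_def)
    then show False using that assms coprime_poly_0[of p q z] by (auto simp: inner_pair_def)
  qed
  then obtain \<alpha> where \<alpha>: "continuous_on UNIV \<alpha>" "strict_mono \<alpha>"
    "\<And>t. \<alpha> (t + 2 * pi) = \<alpha> t + 2 * pi * degree p"
    "\<And>t. poly p (cis t) = cis (\<alpha> t) * (cis t ^ degree p * cnj (poly p (cis t)))"
    using poly_circle_argument[of p] inner_pair_nz[OF assms] c(1) by auto
  have "quotient_map_of_polys p q (Some (cis t)) = Some (cis (\<alpha> t + Arg c))" for t
  proof -
    have "cis t ^ degree p * cnj (poly p (cis t)) = c * poly q (cis t)"
      using poly_conj_reflect[of "cis t" p "degree p"] c(3) unit_inverse_cnj[of "cis t"] by simp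
    then have "poly p (cis t) = cis (\<alpha> t) * (c * poly q (cis t))" using \<alpha>(4)[of t] by metis
    moreover have "c = cis (Arg c)" using c(2) rcis_cmod_Arg[of c] by (simp add: rcis_def)
    moreover have "poly q (cis t) \<noteq> 0" using inner_pair_circle_nz[OF assms] by simp
    ultimately show ?thesis
      by (metis (no_types, lifting) cis_mult mult.assoc nonzero_mult_div_cancel_right quotient_map_Some sphere_point_def)
  qed
  moreover have "continuous_on UNIV (\<lambda>t. \<alpha> t + Arg c)" using \<alpha>(1) by (intro continuous_intros)
  moreover have "strict_mono (\<lambda>t. \<alpha> t + Arg c)" using \<alpha>(2) by (simp add: strict_mono_def)
  ultimately show ?thesis using that[of "\<lambda>t. \<alpha> t + Arg c"] \<alpha>(3) by simp
qed

text \<open>Both lifts are increasing bijections of the line. As they have the same increment, the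
  inverse of \<open>a\<close> composed with \<open>b\<close> commutes with translation by 2 pi and
  so descends to the circle.\<close>

lemma circle_lift_conjugacy:
  fixes a b :: "real \<Rightarrow> real"
  assumes a: "continuous_on UNIV a" "strict_mono a" "\<And>t. a (t + 2 * pi) = a t + D"
    and b: "continuous_on UNIV b" "strict_mono b" "\<And>t. b (t + 2 * pi) = b t + D" and "D > 0"
  obtains k k' where "homeomorphism (sphere 0 1) (sphere 0 1) k k'"
    "\<And>t. \<exists>s. k (cis t) = cis s \<and> a s = b t"
proof -
  have surj: "\<exists>x. f x = y"
    if f: "continuous_on UNIV f" "strict_mono f" "\<And>t. f (t + 2 * pi) = f t + D" for f :: "real \<Rightarrow> real" and y
  proof -
    have up: "f (t + 2 * pi * real m) = f t + D * real m" for m t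
    proof (induction m)
      case (Suc m)
      have "f (t + 2 * pi * real (Suc m)) = f (t + 2 * pi * real m + 2 * pi)" by (simp add: algebra_simps)
      also have "\<dots> = f t + D * real m + D" by (simp only: f(3) Suc)
      finally show ?case by (simp add: algebra_simps)
    qed simp
    obtain m :: nat where m: "\<bar>y - f 0\<bar> / D < real m" using reals_Archimedean2 by blast
    then have m': "\<bar>y - f 0\<bar> < D * real m" using \<open>D > 0\<close> by (simp add: field_simps)
    have "f (- (2 * pi * real m)) \<le> y" using up[of "- (2 * pi * real m)" m] m' by simp
    moreover have "y \<le> f (2 * pi * real m)" using up[of 0 m] m' by simp
    ultimately show ?thesis
      using IVT'[of f "- (2 * pi * real m)" y "2 * pi * real m"] continuous_on_subset[OF f(1)] by auto
  qed
  define \<kappa> where "\<kappa> t = (SOME s. a s = b t)" for t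
  have \<kappa>: "a (\<kappa> t) = b t" for t unfolding \<kappa>_def by (rule someI_ex) (rule surj[OF a])
  have inja: "a x = a y \<longleftrightarrow> x = y" and injb: "b x = b y \<longleftrightarrow> x = y" for x y
    using a(2) b(2) by (simp_all add: strict_mono_eq)
  have mono: "\<kappa> x \<le> \<kappa> y" if "x \<le> y" for x y
    using that \<kappa> strict_mono_less_eq[OF a(2)] strict_mono_less_eq[OF b(2)] by metis
  have ksurj: "\<exists>t. \<kappa> t = s" for s
    using surj[OF b, of "a s"] \<kappa> inja by metis
  have cont: "continuous_on UNIV \<kappa>"
  \<comment> \<open>A monotone function with open range has no jumps.\<close>
  proof (rule continuous_onI_mono)
    have "\<kappa> ` UNIV = UNIV" using ksurj by (auto simp: image_iff) (metis)
    then show "open (\<kappa> ` UNIV)" by simp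
  qed (use mono in auto)
  have per: "\<kappa> (t + 2 * pi) = \<kappa> t + 2 * pi" for t
    using inja a(3) b(3) \<kappa> by metis
  have pern: "\<kappa> (t + 2 * pi * real m) = \<kappa> t + 2 * pi * real m" for t m
  proof (induction m)
    case (Suc m)
    have "\<kappa> (t + 2 * pi * real (Suc m)) = \<kappa> (t + 2 * pi * real m + 2 * pi)" by (simp add: algebra_simps)
    also have "\<dots> = \<kappa> t + 2 * pi * real m + 2 * pi" by (simp only: per Suc)
    finally show ?case by (simp add: algebra_simps)
  qed simp
  have perz: "\<kappa> (t + 2 * pi * of_int m) = \<kappa> t + 2 * pi * of_int m" for t m
  proof (cases "m \<ge> 0")
    case True
    then show ?thesis using pern[of t "nat m"] by simp
  next
    case False
    then show ?thesis using pern[of "t + 2 * pi * of_int m" "nat (- m)"] by simp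
  qed
  have cis_eq: "cis x = cis y \<longleftrightarrow> (\<exists>m::int. x = y + 2 * pi * m)" for x y
    using sin_cos_eq_iff[of x y] by (auto simp: complex_eq_iff)
  define k where "k z = cis (\<kappa> (Arg z))" for z
  have kc: "k (cis t) = cis (\<kappa> t)" for t
  proof -
    have "cis (Arg (cis t)) = cis t" by (simp add: cis_Arg sgn_eq)
    then obtain m :: int where "Arg (cis t) = t + 2 * pi * m" using cis_eq by blast
    then show ?thesis using perz cis_eq by (auto simp: k_def)
  qed
  have cisz: "\<exists>t. z = cis t" if "z \<in> sphere 0 1" for z
    using that rcis_cmod_Arg[of z] by (intro exI[of _ "Arg z"]) (simp add: rcis_def)
  have "continuous_on (sphere 0 1) k"
    unfolding continuous_on_def
  proof
    fix z0 :: complex assume "z0 \<in> sphere 0 1"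
    then obtain t0 where t0: "z0 = cis t0" using cisz by blast
    \<comment> \<open>\<open>Arg\<close> jumps on the negative real axis. Dividing by
      \<open>z0\<close> moves the point under consideration to 1, where \<open>Arg\<close> is
      continuous, and periodicity shows that \<open>k\<close> is unchanged.\<close>
    let ?F = "\<lambda>z. cis (\<kappa> (t0 + Arg (z / z0)))"
    have z0: "z0 \<noteq> 0" using t0 by simp
    have "isCont Arg (z0 / z0)" using z0 by (intro continuous_at_Arg) auto
    then have "((\<lambda>z. Arg (z / z0)) \<longlongrightarrow> Arg (z0 / z0)) (at z0 within sphere 0 1)"
      by (rule isCont_tendsto_compose) (intro tendsto_intros z0)
    then have 1: "((\<lambda>z. t0 + Arg (z / z0)) \<longlongrightarrow> t0 + Arg (z0 / z0)) (at z0 within sphere 0 1)"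
      by (rule tendsto_add[OF tendsto_const])
    have "isCont (\<lambda>t. cis (\<kappa> t)) (t0 + Arg (z0 / z0))"
      using continuous_on_cis[OF cont] by (simp add: continuous_on_eq_continuous_at)
    from isCont_tendsto_compose[OF this 1]
    have lim: "(?F \<longlongrightarrow> ?F z0) (at z0 within sphere 0 1)" .
    have F_eq: "?F z = k z" if z: "z \<in> sphere 0 1" for z
    proof -
      obtain t where t: "z = cis t" using cisz[OF z] by blast
      have "z / z0 \<noteq> 0" "norm (z / z0) = 1" using t t0 by (auto simp: norm_divide)
      then have "cis (t0 + Arg (z / z0)) = z0 * (z / z0)"
        by (simp add: cis_Arg sgn_eq t0 flip: cis_mult)
      then have "z = cis (t0 + Arg (z / z0))" using z0 by simp
      then show ?thesis using kc by metis
    qed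
    from lim have "(?F \<longlongrightarrow> k z0) (at z0 within sphere 0 1)"
      by (simp only: F_eq[OF \<open>z0 \<in> sphere 0 1\<close>])
    moreover have "\<forall>\<^sub>F z in at z0 within sphere 0 1. ?F z = k z"
      using F_eq by (auto simp: eventually_at_filter intro!: always_eventually)
    ultimately show "(k \<longlongrightarrow> k z0) (at z0 within sphere 0 1)"
      by (rule Lim_transform_eventually)
  qed
  moreover have "k ` sphere 0 1 = sphere 0 1"
  proof
    show "k ` sphere 0 1 \<subseteq> sphere 0 1" by (auto simp: k_def)
    show "sphere 0 1 \<subseteq> k ` sphere 0 1"
    proof
      fix z :: complex assume "z \<in> sphere 0 1"
      then obtain s where "z = cis s" using cisz by blast
      moreover obtain t where "\<kappa> t = s" using ksurj by blast
      ultimately have "z = k (cis t)" using kc by simp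
      then show "z \<in> k ` sphere 0 1" by (rule image_eqI) simp
    qed
  qed
  moreover have "inj_on k (sphere 0 1)"
  proof (rule inj_onI)
    fix z w assume zw: "z \<in> sphere 0 1" "w \<in> sphere 0 1" "k z = k w"
    then obtain t s where ts: "z = cis t" "w = cis s" using cisz by metis
    then have "cis (\<kappa> t) = cis (\<kappa> s)" using zw kc by simp
    then obtain m :: int where "\<kappa> t = \<kappa> (s + 2 * pi * m)" using cis_eq perz by metis
    then have "t = s + 2 * pi * m" using \<kappa> injb by metis
    then show "z = w" using ts cis_eq by blast
  qed
  ultimately obtain k' where "homeomorphism (sphere 0 1) (sphere 0 1) k k'"
    using homeomorphism_compact[of "sphere 0 1" k] by auto
  moreover have "\<exists>s. k (cis t) = cis s \<and> a s = b t" for t using kc \<kappa> by blast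
  ultimately show ?thesis using that by blast
qed


section \<open>Lueroth's theorem\<close>

locale subfield =
  fixes K :: "'a::field set"
  assumes one_mem: "1 \<in> K"
    and diff_mem: "\<And>x y. x \<in> K \<Longrightarrow> y \<in> K \<Longrightarrow> x - y \<in> K"
    and mult_mem: "\<And>x y. x \<in> K \<Longrightarrow> y \<in> K \<Longrightarrow> x * y \<in> K"
    and inverse_mem: "\<And>x. x \<in> K \<Longrightarrow> inverse x \<in> K"
begin

lemma zero_mem: "0 \<in> K"
  using diff_mem[OF one_mem one_mem] by simp

lemma divide_mem: "x \<in> K \<Longrightarrow> y \<in> K \<Longrightarrow> x / y \<in> K"
  by (simp add: divide_inverse mult_mem inverse_mem)

text \<open>Long division uses only field operations on the coefficients. The induction runs over
  the length of the coefficient list, which, unlike the degree, separates zero from nonzero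
  constants.\<close>

lemma coeff_mod_mem:
  assumes "\<forall>i. coeff M i \<in> K" "\<forall>i. coeff N i \<in> K"
  shows "coeff (N mod M) i \<in> K"
  using assms(2)
proof (induction "length (coeffs N)" arbitrary: N rule: less_induct)
  case less
  show ?case
  proof (cases "N = 0 \<or> M = 0 \<or> degree N < degree M")
    case True
    then show ?thesis using less.prems by (auto simp: mod_poly_less zero_mem)
  next
    case False
    define T where "T = monom (lead_coeff N / lead_coeff M) (degree N - degree M) * M"
    define N' where "N' = N - T"
    have T: "coeff T i \<in> K" for i
      using assms(1) less.prems
      by (auto simp: T_def coeff_monom_mult intro!: mult_mem divide_mem zero_mem)
    have dT: "degree T = degree N" "lead_coeff T = lead_coeff N"
      using False by (auto simp: T_def degree_mult_eq degree_monom_eq monom_eq_0_iff coeff_monom_mult)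
    have lt: "length (coeffs N') < length (coeffs N)"
    proof (cases "N' = 0")
      case True
      then show ?thesis using False by simp
    next
      case nz: False
      have "coeff N' (degree N) = 0" using dT by (simp add: N'_def)
      moreover have "degree N' \<le> degree N" using dT by (simp add: N'_def degree_diff_le)
      ultimately have "degree N' < degree N"
        using nz by (metis le_neq_implies_less leading_coeff_0_iff)
      then show ?thesis using nz False by (simp add: length_coeffs_degree)
    qed
    have "coeff (N' mod M) i \<in> K"
      by (rule less.hyps[OF lt]) (use less.prems T in \<open>auto simp: N'_def diff_mem\<close>)
    moreover have "N' mod M = N mod M"
      by (simp add: N'_def T_def poly_mod_diff_left)
    ultimately show ?thesis by simp
  qed
qed

end

section \<open>Polynomials in two variables and the rational function field\<close>

abbreviation const_fract :: "complex \<Rightarrow> complex poly fract" where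
  "const_fract c \<equiv> to_fract [:c:]"

abbreviation var_fract :: "complex poly fract" where
  "var_fract \<equiv> to_fract [:0, 1:]"

text \<open>In a polynomial over polynomials the inner variable x is that of the function field and
  the outer one y is new; \<open>lift_poly p\<close> is p(y). Evaluation at \<open>[:y:]\<close>
  fixes y as a number and leaves a polynomial in x.\<close>

abbreviation lift_poly :: "complex poly \<Rightarrow> complex poly poly" where
  "lift_poly \<equiv> map_poly (\<lambda>c. [:c:])"

lemma poly_lift_poly_fract: "poly (fract_poly (lift_poly p)) var_fract = to_fract p"
proof (induction p)
  case (pCons a p)
  have "pCons a p = [:a:] + [:0,1:] * p" by simp
  then have "to_fract (pCons a p) = const_fract a + var_fract * to_fract p"
    by (simp only: to_fract_add to_fract_mult)
  with pCons show ?case by (simp add: map_poly_pCons)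
qed simp

lemma poly_lift_poly: "poly (lift_poly p) [:y:] = [:poly p y:]"
  by (induction p) (auto simp: map_poly_pCons)

lemma degree_lift_poly: "degree (lift_poly p) = degree p"
  by (rule degree_map_poly) auto

text \<open>The slice is the coefficient of x^j viewed as a polynomial in y; slices allow control of
  the degree in x.\<close>

lemma poly_coeff_slice:
  "poly (map_poly (\<lambda>c. coeff c j) P) y = coeff (poly P [:y:]) j"
  by (induction P) (auto simp: map_poly_pCons)

locale rational_subfield = subfield K for K :: "complex poly fract set" +
  assumes const_mem: "const_fract c \<in> K"

context rational_subfield
begin

definition is_min_poly :: "complex poly fract poly \<Rightarrow> bool" where
  "is_min_poly m \<longleftrightarrow> lead_coeff m = 1 \<and> (\<forall>i. coeff m i \<in> K) \<and> poly m var_fract = 0 \<and>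
     (\<forall>N. (\<forall>i. coeff N i \<in> K) \<longrightarrow> poly N var_fract = 0 \<longrightarrow> m dvd N)"

lemma annihilator:
  fixes p q :: "complex poly"
  assumes "Fract p q \<in> K" "q \<noteq> 0"
  shows "(\<forall>i. coeff (fract_poly (lift_poly p) - smult (Fract p q) (fract_poly (lift_poly q))) i \<in> K)"
    and "poly (fract_poly (lift_poly p) - smult (Fract p q) (fract_poly (lift_poly q))) var_fract = 0"
proof -
  show "\<forall>i. coeff (fract_poly (lift_poly p) - smult (Fract p q) (fract_poly (lift_poly q))) i \<in> K"
    using assms by (auto simp: coeff_map_poly intro!: diff_mem mult_mem const_mem)
  show "poly (fract_poly (lift_poly p) - smult (Fract p q) (fract_poly (lift_poly q))) var_fract = 0"
    using assms by (simp add: poly_lift_poly_fract Fract_conv_to_fract)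
qed

text \<open>A nonconstant f = p/q in \<open>K\<close> makes the variable x algebraic over
  \<open>K\<close>, as a root of p(y) - f q(y). A monic annihilator of least degree divides all
  others, since remainders keep their coefficients in \<open>K\<close>.\<close>

lemma min_poly_exists:
  assumes "f \<in> K" "f \<notin> range const_fract"
  shows "\<exists>m. is_min_poly m"
proof -
  define S where "S N \<longleftrightarrow> N \<noteq> 0 \<and> (\<forall>i. coeff N i \<in> K) \<and> poly N var_fract = 0" for N
  obtain p q where pq: "f = Fract p q" "q \<noteq> 0" by (cases f) auto
  let ?N = "fract_poly (lift_poly p) - smult f (fract_poly (lift_poly q))"
  have "?N \<noteq> 0"
  proof
    assume "?N = 0"
    then have "coeff ?N (degree q) = 0" by simp
    then have "const_fract (coeff p (degree q)) = f * const_fract (lead_coeff q)"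
      by (simp add: coeff_map_poly)
    moreover have "const_fract (lead_coeff q) * const_fract (inverse (lead_coeff q)) = 1"
      using pq(2) by (simp flip: to_fract_mult one_pCons)
    ultimately have "f = const_fract (coeff p (degree q)) * const_fract (inverse (lead_coeff q))"
      by (simp add: mult.assoc)
    then have "f = const_fract (coeff p (degree q) * inverse (lead_coeff q))"
      by (simp flip: to_fract_mult add: mult.commute)
    with assms(2) show False by blast
  qed
  then have "S ?N" using annihilator[of p q] pq assms(1) by (simp add: S_def)
  then obtain M where M: "S M" and min: "\<And>N. S N \<Longrightarrow> degree M \<le> degree N"
    using ex_has_least_nat[of S ?N degree] by blast
  define m where "m = smult (inverse (lead_coeff M)) M"
  have m: "lead_coeff m = 1" "\<forall>i. coeff m i \<in> K" "poly m var_fract = 0" "degree m = degree M"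
    using M by (auto simp: m_def S_def inverse_mem mult_mem)
  have "m dvd N" if N: "\<forall>i. coeff N i \<in> K" "poly N var_fract = 0" for N
  proof (rule ccontr)
    assume "\<not> m dvd N"
    then have nz: "N mod m \<noteq> 0" by (simp add: dvd_eq_mod_eq_0)
    have "poly (N mod m) var_fract = 0"
    proof -
      have "poly (N div m * m + N mod m) var_fract = 0" using N(2) by (simp only: div_mult_mod_eq)
      then show ?thesis by (simp only: poly_add poly_mult m(3) mult_zero_right add_0)
    qed
    then have "S (N mod m)"
      using nz coeff_mod_mem[OF m(2) N(1)] by (simp add: S_def)
    then have "degree m \<le> degree (N mod m)" using min m(4) by simp
    moreover have "m \<noteq> 0" using m(1) by auto
    ultimately show False using degree_mod_less[of m N] nz by simp
  qed
  with m show ?thesis unfolding is_min_poly_def by blast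
qed

text \<open>Gauss's lemma: \<open>P\<close> is primitive, so divisibility over the function field
  descends to polynomials in x and y once the denominator \<open>q\<close> is cleared.\<close>

lemma min_poly_dvd:
  assumes "is_min_poly m" "m = smult c (fract_poly P)" "content P = 1"
    and "Fract p q \<in> K" "q \<noteq> 0"
  shows "P dvd smult q (lift_poly p) - smult p (lift_poly q)"
proof -
  let ?N = "fract_poly (lift_poly p) - smult (Fract p q) (fract_poly (lift_poly q))"
  let ?G = "smult q (lift_poly p) - smult p (lift_poly q)"
  have "c \<noteq> 0" using assms(1,2) by (auto simp: is_min_poly_def)
  then have "fract_poly P dvd m" using assms(2) by (simp add: dvd_smult)
  also have "m dvd ?N"
    using assms(1) annihilator[OF assms(4,5)] by (simp add: is_min_poly_def)
  also have "?N dvd smult (to_fract q) ?N" by (simp add: dvd_smult)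
  also have "smult (to_fract q) ?N = fract_poly ?G"
    using assms(5) by (simp add: smult_diff_right Fract_conv_to_fract)
  finally show ?thesis using fract_poly_dvdD assms(3) by blast
qed

text \<open>Any nonconstant coefficient u = g/h of the minimal polynomial generates
  \<open>K\<close>, expressed as: every admissible \<open>L\<close> containing it contains
  \<open>K\<close>. \<open>P\<close> divides G = h(x) g(y) - g(x) h(y), and comparing degrees in x
  shows that the cofactor is constant. So \<open>m\<close> is proportional to g(y) - u h(y) and has
  its coefficients in \<open>L\<close>.\<close>

lemma min_poly_coeff_generator:
  assumes m: "is_min_poly m" "m = smult c (fract_poly P)" "content P = 1"
    and u: "coeff m j \<notin> range const_fract"
    and L: "rational_subfield L" "coeff m j \<in> L"
  shows "K \<subseteq> L"
proof -
  interpret L: rational_subfield L by fact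
  define u where "u = coeff m j"
  define g where "g = fst (quot_of_fract u)"
  define h where "h = snd (quot_of_fract u)"
  have gh: "u = Fract g h" "h \<noteq> 0" "coprime g h" and h0: "h \<noteq> 0"
    by (auto simp: g_def h_def coprime_quot_of_fract)
  have uK: "u \<in> K" using m(1) by (simp add: u_def is_min_poly_def)
  define G where "G = smult h (lift_poly g) - smult g (lift_poly h)"
  have "P dvd G"
    using min_poly_dvd[OF m, of g h] uK gh by (simp add: G_def)
  then obtain Q where Q: "G = P * Q" by (elim dvdE)
  have c0: "c \<noteq> 0" using m(1,2) by (auto simp: is_min_poly_def)
  have P0: "P \<noteq> 0" using m(3) by auto
  have degP: "degree m = degree P" using m(2) c0 by (simp add: degree_map_poly)
  have lc: "c * to_fract (lead_coeff P) = 1"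
    using m(1,2) degP by (simp add: is_min_poly_def coeff_map_poly)
  have uP: "u = c * to_fract (coeff P j)" using m(2) by (simp add: u_def coeff_map_poly)
  have "u * to_fract (lead_coeff P) = to_fract (coeff P j)"
    using lc uP by (simp add: algebra_simps)
  then have "to_fract (g * lead_coeff P) = to_fract (coeff P j * h)"
    using gh h0 by (simp add: Fract_conv_to_fract field_simps)
  then have cross: "g * lead_coeff P = coeff P j * h" by (simp only: to_fract_eq_iff)
  have nonconst: "\<not> (degree g = 0 \<and> degree h = 0)"
  proof
    assume "degree g = 0 \<and> degree h = 0"
    then obtain a b where ab: "g = [:a:]" "h = [:b:]" by (metis degree_eq_zeroE)
    have "u * const_fract b = const_fract a" using gh h0 ab by (simp add: Fract_conv_to_fract)
    moreover have "const_fract b * const_fract (inverse b) = 1"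
      using h0 ab by (simp flip: to_fract_mult one_pCons)
    ultimately have "u = const_fract a * const_fract (inverse b)"
      by (metis (no_types) mult.assoc mult.right_neutral)
    then have "u = const_fract (a * inverse b)" by (simp flip: to_fract_mult add: mult.commute)
    then show False using u by (auto simp: u_def)
  qed
  define \<delta> where "\<delta> = max (degree g) (degree h)"
  have lP0: "lead_coeff P \<noteq> 0" using P0 by simp
  \<comment> \<open>Since \<open>u\<close> in lowest terms is a quotient of two coefficients of
    \<open>P\<close>, its denominator and numerator divide these. Hence some coefficient of
    \<open>P\<close> has degree at least \<delta> in x.\<close>
  have "h dvd lead_coeff P"
  proof -
    have "h dvd g * lead_coeff P" unfolding cross by simp
    with gh(3) show ?thesis
      by (subst (asm) coprime_dvd_mult_right_iff) (simp_all add: coprime_commute)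
  qed
  then have dh: "degree h \<le> degree (lead_coeff P)" using lP0 by (rule dvd_imp_degree_le)
  have dg: "degree g \<le> degree (coeff P j)"
  proof (cases "g = 0")
    case False
    have "g dvd coeff P j"
    proof -
      have "g dvd coeff P j * h" unfolding cross[symmetric] by simp
      with gh(3) show ?thesis by (subst (asm) coprime_dvd_mult_left_iff) simp_all
    qed
    moreover have "coeff P j \<noteq> 0" using cross False lP0 by auto
    ultimately show ?thesis by (rule dvd_imp_degree_le)
  qed simp
  have "\<exists>i. degree (coeff P i) \<ge> \<delta> \<and> coeff P i \<noteq> 0"
  proof (cases "degree h \<ge> degree g")
    case True
    then show ?thesis using dh lP0 by (auto simp: \<delta>_def)
  next
    case False
    then have "coeff P j \<noteq> 0" using dg by auto
    then show ?thesis using False dg by (auto simp: \<delta>_def max_def)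
  qed
  then obtain i where i: "degree (coeff P i) \<ge> \<delta>" "coeff P i \<noteq> 0" by blast
  \<comment> \<open>A slice of \<open>P\<close> at an x-exponent of at least \<delta>. Wherever it
    does not vanish, \<open>P\<close> at that y has degree at least \<delta> in x.\<close>
  define s where "s = map_poly (\<lambda>q. coeff q (degree (coeff P i))) P"
  have "coeff s i \<noteq> 0" using i by (simp add: s_def coeff_map_poly)
  then have s0: "s \<noteq> 0" by auto
  have G_eval: "poly G [:y:] = smult (poly g y) h - smult (poly h y) g" for y
    by (simp add: G_def poly_lift_poly)
  \<comment> \<open>\<open>P\<close> already has the degree of \<open>G\<close> in the inner variable, so \<open>Q\<close> cannot involve it.\<close>
  have Qdeg: "degree (poly Q [:y:]) = 0" if "poly s y \<noteq> 0" for y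
  proof (cases "poly Q [:y:] = 0")
    case False
    have "coeff (poly P [:y:]) (degree (coeff P i)) \<noteq> 0"
      using that by (simp add: s_def poly_coeff_slice)
    then have 1: "\<delta> \<le> degree (poly P [:y:])" "poly P [:y:] \<noteq> 0"
      using i(1) le_degree order_trans by (blast, auto)
    have "degree (poly G [:y:]) \<le> \<delta>"
      unfolding G_eval \<delta>_def by (intro degree_diff_le) (auto simp: le_max_iff_disj)
    with 1 False show ?thesis by (simp add: Q degree_mult_eq)
  qed simp
  \<comment> \<open>The slice of \<open>Q\<close> vanishes off the zeros of \<open>s\<close>, so its
    product with the nonzero polynomial \<open>s\<close> is zero.\<close>
  have Qslice: "map_poly (\<lambda>q. coeff q k) Q = 0" if "k > 0" for k
  proof -
    have "s * map_poly (\<lambda>q. coeff q k) Q = 0"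
    proof (rule poly_all_0_iff_0[THEN iffD1], rule allI)
      fix y
      show "poly (s * map_poly (\<lambda>q. coeff q k) Q) y = 0"
        using Qdeg[of y] that by (cases "poly s y = 0") (auto simp: poly_coeff_slice coeff_eq_0)
    qed
    with s0 show ?thesis by simp
  qed
  have Qc: "coeff (coeff Q l) k = 0" if "k > 0" for l k
    using arg_cong[OF Qslice[OF that], of "\<lambda>p. coeff p l"] by (simp add: coeff_map_poly)
  define t where "t = map_poly (\<lambda>q. coeff q 0) Q"
  have Qt: "Q = lift_poly t"
  proof (rule poly_eqI)
    fix l
    show "coeff Q l = coeff (lift_poly t) l"
      by (rule poly_eqI) (auto simp: t_def coeff_map_poly coeff_pCons Qc split: nat.splits)
  qed
  \<comment> \<open>If G vanished at some y, then \<open>g\<close> and \<open>h\<close> would be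
    proportional, and being coprime they would be constant. Thus the remaining cofactor t(y) has no
    root.\<close>
  have G_nz: "poly G [:y:] \<noteq> 0" for y
  proof
    assume "poly G [:y:] = 0"
    then have e: "smult (poly g y) h = smult (poly h y) g" by (simp add: G_eval)
    have ghy: "poly h y \<noteq> 0"
      using coprime_poly_0[OF gh(3), of y] e h0 by auto
    then have gh': "g = smult (poly g y / poly h y) h"
      using arg_cong[OF e, of "smult (inverse (poly h y))"] by (simp add: field_simps)
    have "h dvd smult (poly g y / poly h y) h" by (simp add: dvd_smult)
    then have "h dvd g" by (simp flip: gh')
    then have "is_unit h" using coprime_common_divisor[OF gh(3)] by simp
    then have "degree h = 0" by (simp add: is_unit_iff_degree h0)
    moreover have "degree g \<le> degree h" by (subst gh') (rule degree_smult_le)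
    ultimately show False using nonconst by simp
  qed
  have "degree t = 0"
  proof (rule ccontr)
    assume "degree t \<noteq> 0"
    then obtain y where y: "poly t y = 0"
      using fundamental_theorem_of_algebra[of t] by (auto simp: constant_degree)
    then have "poly G [:y:] = 0" by (simp add: Q Qt poly_lift_poly)
    then show False using G_nz by simp
  qed
  then obtain t0 where t0: "t = [:t0:]" by (rule degree_eq_zeroE)
  have "t0 \<noteq> 0" using G_nz[of 0] by (auto simp: Q Qt t0)
  define \<kappa> where "\<kappa> = c * to_fract h / const_fract t0"
  have mG: "coeff m i = \<kappa> * (const_fract (coeff g i) - u * const_fract (coeff h i))" for i
  proof -
    have "G = smult [:t0:] P" by (simp add: Q Qt t0 map_poly_pCons)
    then have "fract_poly G = smult (const_fract t0) (fract_poly P)" by simp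
    moreover have "fract_poly G = smult (to_fract h) (fract_poly (lift_poly g) - smult u (fract_poly (lift_poly h)))"
      using h0 by (simp add: G_def smult_diff_right gh(1) Fract_conv_to_fract)
    ultimately have "smult (const_fract t0) (fract_poly P) =
        smult (to_fract h) (fract_poly (lift_poly g) - smult u (fract_poly (lift_poly h)))"
      by simp
    from arg_cong[OF this, of "\<lambda>p. coeff p i"]
    have "const_fract t0 * coeff (fract_poly P) i = to_fract h * (const_fract (coeff g i) - u * const_fract (coeff h i))"
      by (simp add: coeff_map_poly)
    from arg_cong[OF this, of "\<lambda>x. c * x / const_fract t0"]
    show ?thesis using \<open>t0 \<noteq> 0\<close> by (simp add: m(2) \<kappa>_def)
  qed
  \<comment> \<open>Monicity of \<open>m\<close> determines the factor \<kappa>, which might not lie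
    in \<open>L\<close>, and eliminates it.\<close>
  have mL: "\<forall>i. coeff m i \<in> L"
  proof
    fix i
    have 1: "\<kappa> * (const_fract (coeff g (degree m)) - u * const_fract (coeff h (degree m))) = 1"
      using m(1) mG[of "degree m"] by (simp add: is_min_poly_def)
    then have "coeff m i = (const_fract (coeff g i) - u * const_fract (coeff h i)) /
        (const_fract (coeff g (degree m)) - u * const_fract (coeff h (degree m)))"
      by (subst mG) (auto simp: divide_simps mult_ac)
    moreover have "u \<in> L" using L(2) by (simp add: u_def)
    ultimately show "coeff m i \<in> L"
      by (simp add: L.divide_mem L.diff_mem L.mult_mem L.const_mem)
  qed
  show "K \<subseteq> L"
  proof
    fix f assume f: "f \<in> K"
    obtain p q where pq: "f = Fract p q" "q \<noteq> 0" by (cases f) auto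
    \<comment> \<open>Dividing p(y) and q(y) by \<open>m\<close> leaves remainders over
      \<open>L\<close>, and p(y) - f q(y) leaves none. So f is a quotient of corresponding remainder
      coefficients.\<close>
    define Rp where "Rp = fract_poly (lift_poly p) mod m"
    define Rq where "Rq = fract_poly (lift_poly q) mod m"
    have "m dvd fract_poly (lift_poly p) - smult f (fract_poly (lift_poly q))"
      using m(1) annihilator[of p q] f pq by (simp add: is_min_poly_def)
    then have "Rp - smult f Rq = 0"
      by (simp add: Rp_def Rq_def dvd_eq_mod_eq_0 poly_mod_diff_left mod_smult_left)
    then have e: "coeff Rp i = f * coeff Rq i" for i
      by (metis coeff_smult eq_iff_diff_eq_0)
    have "Rq \<noteq> 0"
    proof
      assume "Rq = 0"
      then have "m dvd fract_poly (lift_poly q)" by (simp add: Rq_def dvd_eq_mod_eq_0)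
      moreover have "poly m var_fract = 0" using m(1) by (simp add: is_min_poly_def)
      ultimately have "poly (fract_poly (lift_poly q)) var_fract = 0" by (auto elim: dvdE)
      then have "to_fract q = 0" by (simp only: poly_lift_poly_fract)
      then show False using pq(2) by simp
    qed
    then obtain i where i: "coeff Rq i \<noteq> 0" by (metis leading_coeff_0_iff)
    have "coeff Rp i \<in> L" "coeff Rq i \<in> L"
      unfolding Rp_def Rq_def
      by (rule L.coeff_mod_mem[OF mL]; simp add: coeff_map_poly L.const_mem L.zero_mem)+
    moreover have "f = coeff Rp i / coeff Rq i" using e i by simp
    ultimately show "f \<in> L" by (simp add: L.divide_mem)
  qed
qed

end


section \<open>Fields of rational functions and welding\<close>

text \<open>Division by zero makes this 0 at poles, so identities between evaluations hold only off
  finite sets; \<open>fract_map\<close> is the version with values on the sphere.\<close>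

definition fract_eval :: "complex poly fract \<Rightarrow> complex \<Rightarrow> complex" where
  "fract_eval f z = poly (fst (quot_of_fract f)) z / poly (snd (quot_of_fract f)) z"

definition fract_map :: "complex poly fract \<Rightarrow> complex option \<Rightarrow> complex option" where
  "fract_map f = quotient_map_of_polys (fst (quot_of_fract f)) (snd (quot_of_fract f))"

lemma fract_map_represents:
  "represents_rational (fst (quot_of_fract f)) (snd (quot_of_fract f)) (fract_map f)"
  by (simp add: represents_rational_def fract_map_def coprime_quot_of_fract)

lemma fract_eval_Fract:
  assumes "poly q z \<noteq> 0"
  shows "fract_eval (Fract p q) z = poly p z / poly q z"
proof -
  define a b where "a = fst (quot_of_fract (Fract p q))" and "b = snd (quot_of_fract (Fract p q))"
  have nz: "q \<noteq> 0" "b \<noteq> 0" using assms by (auto simp: b_def)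
  have ab: "Fract a b = Fract p q" "coprime a b" by (auto simp: a_def b_def coprime_quot_of_fract)
  then have cross: "a * q = p * b" using nz by (simp add: eq_fract)
  have "b dvd a * q" unfolding cross by simp
  with ab(2) have "b dvd q" by (subst (asm) coprime_dvd_mult_right_iff) (simp_all add: coprime_commute)
  then have "poly b z \<noteq> 0" using assms by (auto elim!: dvdE)
  moreover have "poly a z * poly q z = poly p z * poly b z"
    using arg_cong[OF cross, of "\<lambda>r. poly r z"] by simp
  ultimately show ?thesis
    using assms by (simp add: fract_eval_def a_def b_def frac_eq_eq)
qed

lemma eventually_poly_nz:
  fixes p :: "complex poly"
  shows "p \<noteq> 0 \<Longrightarrow> \<forall>\<^sub>F z in cofinite. poly p z \<noteq> 0"
  using poly_roots_finite[of p] by (simp add: eventually_cofinite)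

lemma eventually_fract_map_Some: "\<forall>\<^sub>F z in cofinite. fract_map f (Some z) = Some (fract_eval f z)"
proof -
  have "\<forall>\<^sub>F z in cofinite. poly (snd (quot_of_fract f)) z \<noteq> 0"
    by (rule eventually_poly_nz) simp
  then show ?thesis
    by eventually_elim (simp add: fract_map_def quotient_map_Some sphere_point_def fract_eval_def)
qed

lemma eventually_fract_eval_ops:
  "\<forall>\<^sub>F z in cofinite. fract_eval (f - g) z = fract_eval f z - fract_eval g z \<and>
     fract_eval (f * g) z = fract_eval f z * fract_eval g z \<and>
     fract_eval (inverse f) z = inverse (fract_eval f z)"
proof -
  obtain a b where ab: "f = Fract a b" "b \<noteq> 0" by (cases f) auto
  obtain c d where cd: "g = Fract c d" "d \<noteq> 0" by (cases g) auto
  \<comment> \<open>The implication lets \<open>f = 0\<close> through: there the inverse is 0 both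
    as a fraction and as a value.\<close>
  have "\<forall>\<^sub>F z in cofinite. a \<noteq> 0 \<longrightarrow> poly a z \<noteq> 0"
    using eventually_poly_nz[of a] by (cases "a = 0") auto
  then show ?thesis
    using eventually_poly_nz[OF ab(2)] eventually_poly_nz[OF cd(2)]
  proof eventually_elim
    case (elim z)
    have "f - g = Fract (a * d - c * b) (b * d)" "f * g = Fract (a * c) (b * d)" "inverse f = Fract b a"
      using ab cd by simp_all
    moreover have "fract_eval (Fract b a) z = poly b z / poly a z"
    proof (cases "a = 0")
      case True
      then have "Fract b a = 0" by (simp add: fract_collapse)
      then show ?thesis using True by (simp add: fract_eval_def)
    qed (use elim fract_eval_Fract in auto)
    ultimately show ?case
      using elim by (simp add: fract_eval_Fract ab cd field_simps)
  qed
qed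

section \<open>Subfields defined by eventual agreement\<close>

lemma filterlim_cofinite:
  fixes f :: "'a \<Rightarrow> 'b"
  assumes "\<And>w. \<forall>\<^sub>F z in F. f z \<noteq> w"
  shows "filterlim f cofinite F"
  unfolding filterlim_iff
proof (intro allI impI)
  fix P :: "'b \<Rightarrow> bool" assume "eventually P cofinite"
  then have "finite {w. \<not> P w}" by (simp add: eventually_cofinite)
  then have "\<forall>\<^sub>F z in F. \<forall>w\<in>{w. \<not> P w}. f z \<noteq> w"
    using assms by (intro eventually_ball_finite) auto
  then show "\<forall>\<^sub>F z in F. P (f z)" by eventually_elim auto
qed

lemma eventually_filterlim: "eventually P G \<Longrightarrow> filterlim f G F \<Longrightarrow> \<forall>\<^sub>F z in F. P (f z)"
  by (simp add: filterlim_iff)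

text \<open>The limits keep \<alpha> and \<beta> away from the finitely many points where evaluation
  fails to respect the operations. One instance gives the functions carried by the welding map to
  rational functions, another the functions of a given generator.\<close>

lemma fract_agreement_subfield:
  assumes \<alpha>: "filterlim \<alpha> cofinite F" and \<beta>: "filterlim \<beta> cofinite F"
  shows "rational_subfield {f. \<exists>g. \<forall>\<^sub>F z in F. fract_eval f (\<alpha> z) = fract_eval g (\<beta> z)}"
    (is "rational_subfield ?K")
proof -
  have const: "const_fract c \<in> ?K" for c
    by (auto simp: fract_eval_def intro!: exI[of _ "const_fract c"])
  show ?thesis
  proof
    show "1 \<in> ?K" by (auto simp: fract_eval_def intro!: exI[of _ 1])
    show "const_fract c \<in> ?K" for c by (rule const)
    fix f1 f2 assume "f1 \<in> ?K" "f2 \<in> ?K"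
    then obtain g1 g2 where
      1: "\<forall>\<^sub>F z in F. fract_eval f1 (\<alpha> z) = fract_eval g1 (\<beta> z)" and
      2: "\<forall>\<^sub>F z in F. fract_eval f2 (\<alpha> z) = fract_eval g2 (\<beta> z)" by auto
    note ops = eventually_filterlim[OF eventually_fract_eval_ops[of f1 f2] \<alpha>]
      eventually_filterlim[OF eventually_fract_eval_ops[of g1 g2] \<beta>]
    from ops 1 2 have "\<forall>\<^sub>F z in F. fract_eval (f1 - f2) (\<alpha> z) = fract_eval (g1 - g2) (\<beta> z)"
      by eventually_elim simp
    then show "f1 - f2 \<in> ?K" by blast
    from ops 1 2 have "\<forall>\<^sub>F z in F. fract_eval (f1 * f2) (\<alpha> z) = fract_eval (g1 * g2) (\<beta> z)"
      by eventually_elim simp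
    then show "f1 * f2 \<in> ?K" by blast
    from ops 1 have "\<forall>\<^sub>F z in F. fract_eval (inverse f1) (\<alpha> z) = fract_eval (inverse g1) (\<beta> z)"
      by eventually_elim simp
    then show "inverse f1 \<in> ?K" by blast
  qed
qed

section \<open>A Blaschke product generating the subfield\<close>

lemma inner_pair_degree_pos:
  assumes "inner_pair p q" shows "rational_degree (quotient_map_of_polys p q) \<ge> 1"
  using inner_pair_reflect[OF assms] inner_pair_degree[OF assms] by metis

lemma inner_pair_not_const:
  assumes "inner_pair p q" shows "Fract p q \<notin> range const_fract"
proof
  assume "Fract p q \<in> range const_fract"
  then obtain c where "Fract p q = Fract [:c:] 1" by (auto simp: to_fract_def)
  then have p: "p = smult c q" using inner_pair_nz[OF assms] by (simp add: eq_fract mult.commute)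
  have "norm c * norm (poly q 0) < norm (poly q 0)" "norm c * norm (poly q 1) = norm (poly q 1)"
    using assms by (auto simp: inner_pair_def p norm_mult dest: spec[of _ 0] spec[of _ 1])
  moreover have "poly q 1 \<noteq> 0" using inner_pair_circle_nz[OF assms] by simp
  ultimately show False by simp
qed

text \<open>Up to sign, the constant coefficient is the leading coefficient times the product of the
  roots.\<close>

lemma norm_poly_0_unimodular_roots:
  fixes p :: "complex poly"
  assumes "\<And>z. poly p z = 0 \<Longrightarrow> norm z = 1"
  shows "norm (poly p 0) = norm (lead_coeff p)"
proof -
  have "poly p 0 = lead_coeff p * (\<Prod>z|poly p z = 0. (- z) ^ order z p)"
    by (subst (1) complex_poly_decompose[symmetric]) (simp add: poly_prod)
  also have "norm \<dots> = norm (lead_coeff p) * (\<Prod>z|poly p z = 0. norm z ^ order z p)"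
    by (simp add: norm_mult norm_power flip: prod_norm)
  also have "(\<Prod>z|poly p z = 0. norm z ^ order z p) = 1"
    using assms by (intro prod.neutral) auto
  finally show ?thesis by simp
qed

lemma poly_map_poly_eval:
  "poly (map_poly (\<lambda>c. poly c x) P) y = poly (poly P [:y:]) x"
  by (induction P) (auto simp: map_poly_pCons)

lemma poly_fract_poly_to_fract: "poly (fract_poly P) (to_fract x) = to_fract (poly P x)"
  by (induction P) (auto simp: map_poly_pCons)

text \<open>The maximum principle bounds g/h by 1 in the disc; the zero at the origin excludes a
  unimodular constant and makes the bound strict.\<close>

lemma inner_pair_by_max_modulus:
  assumes cop: "coprime g h" and h0: "\<And>x. norm x \<le> 1 \<Longrightarrow> poly h x \<noteq> 0"
    and T: "\<And>x. norm x = 1 \<Longrightarrow> norm (poly g x) = norm (poly h x)" and g0: "poly g 0 = 0"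
  shows "inner_pair g h"
proof -
  define f where "f z = poly g z / poly h z" for z
  have hol: "f holomorphic_on ball 0 1"
    unfolding f_def by (intro holomorphic_intros) (use h0 in auto)
  have cont: "continuous_on (cball 0 1) f"
    unfolding f_def by (intro continuous_intros) (use h0 in auto)
  have le: "norm (f z) \<le> 1" if "z \<in> ball 0 1" for z
  proof (rule maximum_modulus_frontier[where S = "ball 0 1" and f = f])
    show "norm (f w) \<le> 1" if "w \<in> frontier (ball 0 1)" for w
      using that T[of w] h0[of w] by (simp add: f_def norm_divide)
  qed (use hol cont that in auto)
  have "norm (poly g z) < norm (poly h z)" if z: "norm z < 1" for z
  proof -
    have "norm (f z) \<noteq> 1"
    proof
      assume 1: "norm (f z) = 1"
      have "f constant_on ball 0 1"
        by (rule maximum_modulus_principle[OF hol, of "ball 0 1" z]) (use 1 le z in auto)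
      then have "f z = f 0" using z by (auto simp: constant_on_def)
      moreover have "f 0 = 0" by (simp add: f_def g0)
      ultimately show False using 1 by simp
    qed
    then have "norm (f z) < 1" using le[of z] z by simp
    then show ?thesis using h0[of z] z by (simp add: f_def norm_divide)
  qed
  then show ?thesis using cop T by (simp add: inner_pair_def)
qed

lemma (in rational_subfield) inner_generator:
  assumes pq: "inner_pair p q" "Fract p q \<in> K"
  obtains g h where "inner_pair g h" "Fract g h \<in> K"
    "\<And>L. rational_subfield L \<Longrightarrow> Fract g h \<in> L \<Longrightarrow> K \<subseteq> L"
proof -
  obtain m where m: "is_min_poly m"
    using min_poly_exists[OF pq(2) inner_pair_not_const[OF pq(1)]] by blast
  obtain c P where cP: "m = smult c (fract_poly P)" "content P = 1"
    using content_decompose_fract[of m] by blast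
  have c0: "c \<noteq> 0" using m cP by (auto simp: is_min_poly_def)
  have degP: "degree m = degree P" using cP c0 by (simp add: degree_map_poly)
  have q0: "q \<noteq> 0" using inner_pair_nz[OF pq(1)] by blast
  define W where "W = smult q (lift_poly p) - smult p (lift_poly q)"
  obtain Q where Q: "W = P * Q"
    using min_poly_dvd[OF m cP pq(2) q0] by (auto simp: W_def elim: dvdE)
  define n where "n = degree p"
  have c': "degree q \<le> n" "norm (coeff q n) < norm (coeff p n)"
    using inner_pair_reflect[OF pq(1)] unfolding n_def by metis+
  \<comment> \<open>The top coefficient in y is p_n q(x) - q_n p(x), where |q_n| < |p_n| and |p(x)|
    \<le> |q(x)| with q(x) nonzero. Hence the leading coefficient of \<open>P\<close>, and later its
    divisor \<open>h\<close>, has no zero in the closed disc.\<close>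
  have W_top: "poly (coeff W n) x \<noteq> 0" if "norm x \<le> 1" for x
  proof
    assume "poly (coeff W n) x = 0"
    then have "coeff p n * poly q x = coeff q n * poly p x"
      by (simp add: W_def coeff_map_poly mult.commute)
    then have "norm (coeff p n) * norm (poly q x) = norm (coeff q n) * norm (poly p x)"
      by (metis norm_mult)
    also have "\<dots> \<le> norm (coeff q n) * norm (poly q x)"
      using pq(1) that by (intro mult_left_mono) (auto simp: inner_pair_def le_less)
    finally show False using c'(2) inner_pair_circle_nz[OF pq(1) that] by simp
  qed
  have "degree W \<le> n"
    unfolding W_def using c'(1) by (intro degree_diff_le degree_smult_le[THEN order_trans])
      (auto simp: degree_lift_poly n_def)
  moreover have "coeff W n \<noteq> 0" using W_top[of 0] by auto
  ultimately have "n = degree W" using le_degree[of W n] by simp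
  then have W_lead: "coeff W n = lead_coeff P * lead_coeff Q" by (simp add: Q lead_coeff_mult)
  have lP: "poly (lead_coeff P) x \<noteq> 0" if "norm x \<le> 1" for x
    using W_top[OF that] by (auto simp: W_lead)
  have W_zero: "poly p y * poly q x = poly p x * poly q y" if "poly (poly P [:y:]) x = 0" for x y
  proof -
    have "poly (poly W [:y:]) x = 0" using that by (simp add: Q)
    then show ?thesis by (simp add: W_def poly_lift_poly mult_ac)
  qed
  have circ: "norm (poly (coeff P 0) x) = norm (poly (lead_coeff P) x)" if x: "norm x = 1" for x
  proof -
    \<comment> \<open>P(x, y) as a polynomial in y for fixed x on the circle. Its roots lie in the
      fibre of p/q through x, hence on the circle, and its degree does not drop.\<close>
    define R where "R = map_poly (\<lambda>c. poly c x) P"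
    have "degree R = degree P" using lP[of x] x by (simp add: R_def map_poly_degree_eq)
    then have lR: "lead_coeff R = poly (lead_coeff P) x" by (simp add: R_def coeff_map_poly)
    have "norm y = 1" if "poly R y = 0" for y
    proof -
      have "poly p y * poly q x = poly p x * poly q y"
        using that by (intro W_zero) (simp add: R_def poly_map_poly_eval)
      then have "norm (poly p y) * norm (poly q x) = norm (poly p x) * norm (poly q y)"
        by (metis norm_mult)
      moreover have "norm (poly p x) = norm (poly q x)" "poly q x \<noteq> 0"
        using pq(1) x inner_pair_circle_nz[OF pq(1)] by (auto simp: inner_pair_def)
      ultimately have "norm (poly p y) = norm (poly q y)" by simp
      then show ?thesis
        using pq(1) inner_pair_outside[OF pq(1), of y] by (metis inner_pair_def less_irrefl not_less_iff_gr_or_eq)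
    qed
    then have "norm (poly R 0) = norm (lead_coeff R)" by (rule norm_poly_0_unimodular_roots)
    then show ?thesis by (simp add: lR) (simp add: R_def poly_0_coeff_0 coeff_map_poly)
  qed
  define u where "u = coeff m 0"
  define g where "g = fst (quot_of_fract u)"
  define h where "h = snd (quot_of_fract u)"
  have gh: "u = Fract g h" "coprime g h" "h \<noteq> 0"
    by (auto simp: g_def h_def coprime_quot_of_fract)
  have lc: "c * to_fract (lead_coeff P) = 1"
    using m cP degP by (simp add: is_min_poly_def coeff_map_poly)
  have "u * to_fract (lead_coeff P) = to_fract (coeff P 0)"
    using lc cP by (simp add: u_def coeff_map_poly algebra_simps)
  then have "to_fract (g * lead_coeff P) = to_fract (coeff P 0 * h)"
    using gh by (simp add: Fract_conv_to_fract field_simps)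
  then have cross: "g * lead_coeff P = coeff P 0 * h" by (simp only: to_fract_eq_iff)
  have "h dvd g * lead_coeff P" unfolding cross by simp
  with gh(2) have "h dvd lead_coeff P"
    by (subst (asm) coprime_dvd_mult_right_iff) (simp_all add: coprime_commute)
  then have h0: "poly h x \<noteq> 0" if "norm x \<le> 1" for x
    using lP[OF that] by (auto elim!: dvdE)
  have cross': "poly g x * poly (lead_coeff P) x = poly (coeff P 0) x * poly h x" for x
    using arg_cong[OF cross, of "\<lambda>r. poly r x"] by simp
  \<comment> \<open>P(x, x) vanishes because x is a root of \<open>m\<close>; at x = 0 this gives
    the zero of the generator at the origin.\<close>
  have "poly P [:0, 1:] = 0"
    using m cP c0 by (simp add: is_min_poly_def poly_fract_poly_to_fract)
  moreover have "poly (poly P [:0, 1:]) 0 = poly (coeff P 0) 0" by (cases P) simp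
  ultimately have "poly (coeff P 0) 0 = 0" by simp
  then have "poly g 0 = 0" using cross'[of 0] lP[of 0] by simp
  moreover have "norm (poly g x) = norm (poly h x)" if x: "norm x = 1" for x
    using arg_cong[OF cross'[of x], of norm] circ[OF x] lP[of x] x by (simp add: norm_mult)
  ultimately have inner: "inner_pair g h" using inner_pair_by_max_modulus gh(2) h0 by blast
  moreover have "Fract g h \<in> K" using m by (simp add: u_def is_min_poly_def flip: gh(1))
  moreover have "K \<subseteq> L" if "rational_subfield L" "Fract g h \<in> L" for L
    using min_poly_coeff_generator[OF m cP, of 0 L] inner_pair_not_const[OF inner] that
    by (simp add: gh(1)[symmetric] u_def)
  ultimately show ?thesis using that by blast
qed


section \<open>From the generator to the four identities\<close>

lemma inner_pair_Some_eval:
  assumes "inner_pair p q" "norm z \<le> 1"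
  shows "quotient_map_of_polys p q (Some z) = Some (fract_eval (Fract p q) z)"
  using inner_pair_circle_nz[OF assms]
  by (simp add: quotient_map_Some sphere_point_def fract_eval_Fract)

lemma rational_degree_0_const:
  assumes "represents_rational p q f" "rational_degree f = 0"
  shows "\<exists>w. \<forall>z. f (Some z) = w"
proof -
  have "degree p = 0" "degree q = 0" using rational_degree_eq[OF assms(1)] assms(2) by auto
  then obtain a b where "p = [:a:]" "q = [:b:]" by (metis degree_eq_zeroE)
  then show ?thesis using assms(1) by (auto simp: represents_rational_def quotient_map_Some)
qed

abbreviation circle_cofinite :: "complex filter" where
  "circle_cofinite \<equiv> inf cofinite (principal (sphere 0 1))"

lemma eventually_circle_cofinite:
  "eventually P circle_cofinite \<longleftrightarrow> finite {z \<in> sphere 0 1. \<not> P z}"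
  by (simp add: eventually_inf_principal eventually_cofinite)

lemma eventually_circleI: "(\<And>z. z \<in> sphere 0 1 \<Longrightarrow> P z) \<Longrightarrow> eventually P circle_cofinite"
  by (simp add: eventually_inf_principal)

lemma eventually_circle_infinite:
  assumes "eventually P circle_cofinite"
  shows "infinite {z. P z}"
proof
  assume "finite {z. P z}"
  then have "finite ({z \<in> sphere 0 1. \<not> P z} \<union> {z. P z})"
    using assms by (simp add: eventually_circle_cofinite)
  then have "finite (sphere 0 1 :: complex set)" by (rule rev_finite_subset) auto
  then show False using infinite_unit_circle by simp
qed

text \<open>\<open>c\<close> writes \<open>A\<close> as a function of \<open>A1\<close>, and
  \<open>v\<close> is the rational function agreeing with \<open>A1\<close> after \<open>k\<close>.
  Agreement on the circle off a finite set yields equality on the sphere, and full invariance of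
  disc and circle passes from \<open>A\<close>, \<open>A1\<close> to the outer factor and then from
  \<open>B\<close> to the inner one.\<close>

lemma welding_factor:
  assumes A: "inner_pair p q" "A = quotient_map_of_polys p q" and B: "blaschke_product B"
    and gh: "inner_pair g h" "A1 = quotient_map_of_polys g h"
    and k: "filterlim k circle_cofinite circle_cofinite"
    and weld: "\<And>z. z \<in> sphere 0 1 \<Longrightarrow> A (Some (k z)) = B (Some z)"
    and v: "\<forall>\<^sub>F z in circle_cofinite. fract_eval (Fract g h) (k z) = fract_eval v z"
    and c: "\<forall>\<^sub>F z in circle_cofinite. fract_eval (Fract p q) z = fract_eval c (fract_eval (Fract g h) z)"
  shows "blaschke_product (fract_map c)" "blaschke_product (fract_map v)"
    "A = fract_map c \<circ> A1" "B = fract_map c \<circ> fract_map v"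
proof -
  let ?F = circle_cofinite and ?u = "fract_eval (Fract g h)"
  have repA: "represents_rational p q A" and repA1: "represents_rational g h A1"
    using inner_pair_represents A gh by auto
  obtain r s where B': "inner_pair r s" "B = quotient_map_of_polys r s"
    using blaschke_imp_inner_pair[OF B] by blast
  then have repB: "represents_rational r s B" using inner_pair_represents by auto
  have degs: "rational_degree A \<ge> 1" "rational_degree A1 \<ge> 1" "rational_degree B \<ge> 1"
    using inner_pair_degree_pos[OF A(1)] inner_pair_degree_pos[OF gh(1)] inner_pair_degree_pos[OF B'(1)]
    by (simp_all add: A(2) gh(2) B'(2))
  have on_circle: "\<forall>\<^sub>F z in ?F. norm z = 1" by (rule eventually_circleI) simp
  have A1_eval: "\<forall>\<^sub>F z in ?F. A1 (Some z) = Some (?u z)"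
    using on_circle by eventually_elim (simp add: gh inner_pair_Some_eval)
  have cof: "\<forall>\<^sub>F z in ?F. P z" if "\<forall>\<^sub>F z in cofinite. P z" for P
    using that by (simp add: eventually_inf_principal eventually_mono)
  have fib: "\<forall>\<^sub>F z in ?F. f (Some z) \<noteq> w" if "represents_rational a b f" "rational_degree f \<ge> 1" for a b f w
    using rational_fibre_finite[OF that, of w] by (intro cof) (simp add: eventually_cofinite)
  \<comment> \<open>Finite fibres of \<open>A1\<close> keep its values away from the poles of
    \<open>c\<close>.\<close>
  have u_lim: "filterlim ?u cofinite ?F"
  proof (rule filterlim_cofinite)
    fix w
    show "\<forall>\<^sub>F z in ?F. ?u z \<noteq> w"
      using fib[OF repA1 degs(2), of "Some w"] A1_eval by eventually_elim auto
  qed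
  have c_eval: "\<forall>\<^sub>F z in ?F. fract_map c (Some (?u z)) = Some (fract_eval c (?u z))"
    using eventually_fract_map_Some u_lim by (rule eventually_filterlim)
  have A_eq: "\<forall>\<^sub>F z in ?F. A (Some z) = (fract_map c \<circ> A1) (Some z)"
    using on_circle A1_eval c_eval c
    by eventually_elim (simp add: A inner_pair_Some_eval)
  \<comment> \<open>A constant outer factor would give \<open>A\<close> an infinite fibre.\<close>
  have degC: "rational_degree (fract_map c) \<ge> 1"
  proof (rule ccontr)
    assume "\<not> rational_degree (fract_map c) \<ge> 1"
    then obtain w where w: "\<And>z. fract_map c (Some z) = w"
      using rational_degree_0_const[OF fract_map_represents, of c] by auto
    from A_eq A1_eval fib[OF repA degs(1), of w] have "\<forall>\<^sub>F z in ?F. False"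
      by eventually_elim (simp add: w)
    then show False using eventually_circle_infinite by fastforce
  qed
  show AC: "A = fract_map c \<circ> A1"
    by (rule rational_eq_if_infinite[OF repA represents_compose(1)[OF fract_map_represents repA1 degC degs(2)]])
      (rule eventually_circle_infinite[OF A_eq])
  show C: "blaschke_product (fract_map c)"
  proof (rule blaschkeI[OF fract_map_represents])
    fix w :: complex
    have *: "\<exists>z. A1 z = Some w \<and> fract_map c (Some w) = A z" if "norm w \<le> 1"
      using inner_pair_surj[OF gh(1) that] AC gh(2) by (metis comp_apply)
    show "fract_map c (Some w) \<in> unit_disc" if "norm w < 1"
    proof -
      obtain z where z: "A1 z = Some w" "fract_map c (Some w) = A z" using * \<open>norm w < 1\<close> by auto
      have "A1 z \<in> unit_disc" using z(1) \<open>norm w < 1\<close> by simp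
      then have "z \<in> unit_disc" using inner_pair_disc_circle(1)[OF gh] by blast
      then show ?thesis using z(2) inner_pair_disc_circle(1)[OF A] by metis
    qed
    show "fract_map c (Some w) \<in> Some ` sphere 0 1" if "norm w = 1"
    proof -
      obtain z where z: "A1 z = Some w" "fract_map c (Some w) = A z" using * \<open>norm w = 1\<close> by auto
      have "A1 z \<in> Some ` sphere 0 1" using z(1) \<open>norm w = 1\<close> by simp
      then have "z \<in> Some ` sphere 0 1" using inner_pair_disc_circle(2)[OF gh] by blast
      then show ?thesis using z(2) inner_pair_disc_circle(2)[OF A] by metis
    qed
  qed
  have v_eval: "\<forall>\<^sub>F z in ?F. fract_map v (Some z) = Some (fract_eval v z)"
    by (rule cof) (rule eventually_fract_map_Some)
  \<comment> \<open>At z on the circle, B(z) = A(k z) = C(A1(k z)) = C(v z), with C the map of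
    \<open>c\<close>, up to finitely many exceptions.\<close>
  have B_eq: "\<forall>\<^sub>F z in ?F. B (Some z) = (fract_map c \<circ> fract_map v) (Some z)"
    using on_circle v v_eval eventually_filterlim[OF A1_eval k]
    by eventually_elim (simp add: AC flip: weld)
  have degV: "rational_degree (fract_map v) \<ge> 1"
  proof (rule ccontr)
    assume "\<not> rational_degree (fract_map v) \<ge> 1"
    then obtain w where w: "\<And>z. fract_map v (Some z) = w"
      using rational_degree_0_const[OF fract_map_represents, of v] by auto
    from B_eq fib[OF repB degs(3), of "fract_map c w"] have "\<forall>\<^sub>F z in ?F. False"
      by eventually_elim (simp add: w)
    then show False using eventually_circle_infinite by fastforce
  qed
  show BC: "B = fract_map c \<circ> fract_map v"
    by (rule rational_eq_if_infinite[OF repB represents_compose(1)[OF fract_map_represents fract_map_represents degC degV]])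
      (rule eventually_circle_infinite[OF B_eq])
  show "blaschke_product (fract_map v)"
  proof (rule blaschkeI[OF fract_map_represents])
    fix z :: complex
    have e: "B (Some z) = fract_map c (fract_map v (Some z))" using BC by simp
    show "fract_map v (Some z) \<in> unit_disc" if "norm z < 1"
    proof -
      have "B (Some z) \<in> unit_disc" using blaschke_disc_circle(1)[OF B, of "Some z"] that by simp
      then show ?thesis unfolding e by (simp only: blaschke_disc_circle(1)[OF C])
    qed
    show "fract_map v (Some z) \<in> Some ` sphere 0 1" if "norm z = 1"
    proof -
      have "B (Some z) \<in> Some ` sphere 0 1" using blaschke_disc_circle(2)[OF B, of "Some z"] that by simp
      then show ?thesis unfolding e by (simp only: blaschke_disc_circle(2)[OF C])
    qed
  qed
qed

lemma blaschke_same_degree_welding: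
  assumes "blaschke_product A" "blaschke_product B" "rational_degree A = rational_degree B"
  obtains k where "welding_homeomorphism A B k"
proof -
  obtain p q where A: "inner_pair p q" "A = quotient_map_of_polys p q"
    using blaschke_imp_inner_pair[OF assms(1)] by blast
  obtain r s where B: "inner_pair r s" "B = quotient_map_of_polys r s"
    using blaschke_imp_inner_pair[OF assms(2)] by blast
  have deg: "degree p = degree r" "degree p \<ge> 1"
    using assms(3) inner_pair_degree_pos[OF A(1)]
    by (simp_all add: A(2) B(2) inner_pair_degree[OF A(1)] inner_pair_degree[OF B(1)])
  obtain a where a: "continuous_on UNIV a" "strict_mono a" "\<And>t. a (t + 2 * pi) = a t + 2 * pi * degree p"
    "\<And>t. A (Some (cis t)) = Some (cis (a t))"
    using inner_pair_circle_lift[OF A(1)] A(2) by metis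
  obtain b where b: "continuous_on UNIV b" "strict_mono b" "\<And>t. b (t + 2 * pi) = b t + 2 * pi * degree p"
    "\<And>t. B (Some (cis t)) = Some (cis (b t))"
    using inner_pair_circle_lift[OF B(1)] B(2) deg by metis
  obtain k k' where k: "homeomorphism (sphere 0 1) (sphere 0 1) k k'"
    "\<And>t. \<exists>s. k (cis t) = cis s \<and> a s = b t"
    using circle_lift_conjugacy[OF a(1-3) b(1-3)] deg(2) by auto
  have "A (Some (k z)) = B (Some z)" if "z \<in> sphere 0 1" for z
  proof -
    have z: "z = cis (Arg z)" using that rcis_cmod_Arg[of z] by (simp add: rcis_def)
    obtain s where "k (cis (Arg z)) = cis s" "a s = b (Arg z)" using k(2) by blast
    then show ?thesis using a(4)[of s] b(4)[of "Arg z"] z by simp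
  qed
  then show ?thesis using k(1) that[of k] by (auto simp: welding_homeomorphism_def)
qed

theorem theorem1:
  fixes A B As Bs :: "complex option \<Rightarrow> complex option"
  assumes "blaschke_product A" and "blaschke_product B"
    and "rational_degree A = rational_degree B"
    and "blaschke_product As" and "blaschke_product Bs"
    and "rational_degree As = rational_degree Bs"
  shows "(\<exists>k. welding_homeomorphism A B k \<and> welding_homeomorphism As Bs k) \<longleftrightarrow>
         (\<exists>A1 B1 C Cs.
            blaschke_product A1 \<and> blaschke_product B1 \<and>
            blaschke_product C \<and> blaschke_product Cs \<and>
            A = C \<circ> A1 \<and> B = C \<circ> B1 \<and> As = Cs \<circ> A1 \<and> Bs = Cs \<circ> B1)"
proof
  assume "\<exists>k. welding_homeomorphism A B k \<and> welding_homeomorphism As Bs k"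
  then obtain k k' where hom: "homeomorphism (sphere 0 1) (sphere 0 1) k k'"
    and weld: "\<And>z. z \<in> sphere 0 1 \<Longrightarrow> A (Some (k z)) = B (Some z)"
      "\<And>z. z \<in> sphere 0 1 \<Longrightarrow> As (Some (k z)) = Bs (Some z)"
    by (auto simp: welding_homeomorphism_def)
  let ?F = circle_cofinite
  have kT: "k z \<in> sphere 0 1" if "z \<in> sphere 0 1" for z
    using hom that by (auto simp: homeomorphism_def)
  \<comment> \<open>Since \<open>k\<close> is injective, each value is taken at most once on the
    circle.\<close>
  have "filterlim k cofinite ?F"
  proof (rule filterlim_cofinite)
    fix w
    have "{z \<in> sphere 0 1. \<not> k z \<noteq> w} \<subseteq> {k' w}" using hom by (auto simp: homeomorphism_def)
    then show "\<forall>\<^sub>F z in ?F. k z \<noteq> w"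
      unfolding eventually_circle_cofinite using finite_subset by blast
  qed
  moreover have "\<forall>\<^sub>F z in ?F. k z \<in> sphere 0 1"
    using kT by (rule eventually_circleI)
  ultimately have k: "filterlim k ?F ?F" "filterlim k cofinite ?F"
    by (simp_all add: filterlim_inf filterlim_principal)
  have id: "filterlim (\<lambda>z. z) cofinite ?F" by (rule filterlim_mono[OF filterlim_ident order_refl inf_le1])
  define K where "K = {f. \<exists>g. \<forall>\<^sub>F z in ?F. fract_eval f (k z) = fract_eval g z}"
  interpret K: rational_subfield K
    unfolding K_def by (rule fract_agreement_subfield[OF k(2) id])
  have in_K: "\<exists>p q. inner_pair p q \<and> X = quotient_map_of_polys p q \<and> Fract p q \<in> K"
    if X: "blaschke_product X" and Y: "blaschke_product Y"
      and XY: "\<And>z. z \<in> sphere 0 1 \<Longrightarrow> X (Some (k z)) = Y (Some z)" for X Y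
  proof -
    obtain p q where p: "inner_pair p q" "X = quotient_map_of_polys p q"
      using blaschke_imp_inner_pair[OF X] by blast
    obtain r s where r: "inner_pair r s" "Y = quotient_map_of_polys r s"
      using blaschke_imp_inner_pair[OF Y] by blast
    have "fract_eval (Fract p q) (k z) = fract_eval (Fract r s) z" if "z \<in> sphere 0 1" for z
      using XY[OF that] kT[OF that] that inner_pair_Some_eval[OF p(1), of "k z"] inner_pair_Some_eval[OF r(1), of z]
      by (simp add: p(2) r(2))
    then have "\<forall>\<^sub>F z in ?F. fract_eval (Fract p q) (k z) = fract_eval (Fract r s) z"
      by (rule eventually_circleI)
    then have "Fract p q \<in> K" by (auto simp: K_def)
    with p show ?thesis by blast
  qed
  obtain p q where A: "inner_pair p q" "A = quotient_map_of_polys p q" "Fract p q \<in> K"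
    using in_K[OF assms(1,2) weld(1)] by blast
  obtain ps qs where As: "inner_pair ps qs" "As = quotient_map_of_polys ps qs" "Fract ps qs \<in> K"
    using in_K[OF assms(4,5) weld(2)] by blast
  obtain g h where gh: "inner_pair g h" "Fract g h \<in> K"
    and gen: "\<And>L. rational_subfield L \<Longrightarrow> Fract g h \<in> L \<Longrightarrow> K \<subseteq> L"
    using K.inner_generator[OF A(1,3)] by blast
  define A1 where "A1 = quotient_map_of_polys g h"
  obtain v where v: "\<forall>\<^sub>F z in ?F. fract_eval (Fract g h) (k z) = fract_eval v z"
    using gh(2) by (auto simp: K_def)
  have u_lim: "filterlim (fract_eval (Fract g h)) cofinite ?F"
  proof (rule filterlim_cofinite)
    fix w
    have "rational_degree A1 \<ge> 1" unfolding A1_def by (rule inner_pair_degree_pos[OF gh(1)])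
    then have "finite {z. A1 (Some z) = Some w}"
      using rational_fibre_finite inner_pair_represents[OF gh(1)] A1_def by blast
    moreover have "{z \<in> sphere 0 1. \<not> fract_eval (Fract g h) z \<noteq> w} \<subseteq> {z. A1 (Some z) = Some w}"
      by (auto simp: A1_def inner_pair_Some_eval[OF gh(1)])
    ultimately show "\<forall>\<^sub>F z in ?F. fract_eval (Fract g h) z \<noteq> w"
      unfolding eventually_circle_cofinite using finite_subset by blast
  qed
  \<comment> \<open>The rational functions of \<open>A1\<close>. This subfield contains the
    generator, with the identity \<open>var_fract\<close> as witness, hence all of \<open>K\<close>
    and in particular both welded products.\<close>
  define L where "L = {f. \<exists>c. \<forall>\<^sub>F z in ?F. fract_eval f z = fract_eval c (fract_eval (Fract g h) z)}"
  have "rational_subfield L" unfolding L_def by (rule fract_agreement_subfield[OF id u_lim])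
  moreover have "Fract g h \<in> L"
    by (auto simp: L_def fract_eval_def[of var_fract] intro!: exI[of _ var_fract])
  ultimately have KL: "K \<subseteq> L" by (rule gen)
  obtain c where c: "\<forall>\<^sub>F z in ?F. fract_eval (Fract p q) z = fract_eval c (fract_eval (Fract g h) z)"
    using A(3) KL by (auto simp: L_def)
  obtain cs where cs: "\<forall>\<^sub>F z in ?F. fract_eval (Fract ps qs) z = fract_eval cs (fract_eval (Fract g h) z)"
    using As(3) KL by (auto simp: L_def)
  \<comment> \<open>The same generator and the same \<open>v\<close> serve both pairs, so the inner
    factors are shared.\<close>
  note f = welding_factor[OF A(1,2) assms(2) gh(1) A1_def k(1) weld(1) v c]
    welding_factor[OF As(1,2) assms(5) gh(1) A1_def k(1) weld(2) v cs]
  have "blaschke_product A1" using inner_pair_imp_blaschke[OF gh(1)] A1_def by simp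
  then show "\<exists>A1 B1 C Cs. blaschke_product A1 \<and> blaschke_product B1 \<and>
      blaschke_product C \<and> blaschke_product Cs \<and>
      A = C \<circ> A1 \<and> B = C \<circ> B1 \<and> As = Cs \<circ> A1 \<and> Bs = Cs \<circ> B1"
    using f by (intro exI conjI)
next
  assume "\<exists>A1 B1 C Cs. blaschke_product A1 \<and> blaschke_product B1 \<and>
      blaschke_product C \<and> blaschke_product Cs \<and>
      A = C \<circ> A1 \<and> B = C \<circ> B1 \<and> As = Cs \<circ> A1 \<and> Bs = Cs \<circ> B1"
  then obtain A1 B1 C Cs where f: "blaschke_product A1" "blaschke_product B1" "blaschke_product C"
    "A = C \<circ> A1" "B = C \<circ> B1" "As = Cs \<circ> A1" "Bs = Cs \<circ> B1" by blast
  \<comment> \<open>Degrees multiply, so equal degrees of \<open>A\<close> and \<open>B\<close> give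
    equal degrees of the inner factors after cancelling that of \<open>C\<close>.\<close>
  have deg: "rational_degree (C \<circ> X) = rational_degree C * rational_degree X" if "blaschke_product X" for X
    using that f(3) represents_compose(2) by (auto simp: blaschke_product_def rational_map_def)
  have "rational_degree C \<ge> 1" using f(3) by (simp add: blaschke_product_def)
  then have "rational_degree A1 = rational_degree B1"
    using assms(3) deg[OF f(1)] deg[OF f(2)] f(4,5) by simp
  then obtain k where "welding_homeomorphism A1 B1 k"
    using blaschke_same_degree_welding f(1,2) by blast
  \<comment> \<open>A welding of the inner factors welds both pairs after composition with
    \<open>C\<close> and \<open>Cs\<close> on the left.\<close>
  then show "\<exists>k. welding_homeomorphism A B k \<and> welding_homeomorphism As Bs k"
    by (auto simp: welding_homeomorphism_def f)
qed

end
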